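(* Let $u$ be an admissible function, let $\underline{\lambda},\overline{\lambda}\in\mathbf{R}_{>0}$, let $X$ and $Y$ be proper geodesic hyperbolic metric spaces, and let $f:X\to Y$ be a $(\underline{\lambda},\overline{\lambda},O(u))$-sublinearly biLipschitz equivalence. Then $f$ induces a map $\varphi:\partial_\infty X\to\partial_\infty Y$ between the geodesic boundaries with the following property: there exist a function $v=O(u)$ (in particular $v$ is sublinear) and a threshold $\mathcal{E}>0$ such that for all pairwise distinct $\xi_1,\xi_2,\xi_3,\xi_4\in\partial_\infty X$ whose pairwise visual distances are all smaller than $\mathcal{E}$, $$\underline{\lambda}\,\log^+[\xi_1,\xi_2,\xi_3,\xi_4]-v\big(\overline{\boxtimes}\{\xi_i\}\big)\;\leqslant\;\log^+[\varphi(\xi_1),\varphi(\xi_2),\varphi(\xi_3),\varphi(\xi_4)]\;\leqslant\;\overline{\lambda}\,\log^+[\xi_1,\xi_2,\xi_3,\xi_4]+v\big(\overline{\boxtimes}\{\xi_i\}\big).$$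
   Context: Distances are written $|x-x'|$; each space has a fixed base-point $o$, $|x|$ denotes the distance from $x$ to the base-point, and $r\vee s=\max(r,s)$. A function $u:\mathbf{R}_{\geqslant0}\to\mathbf{R}_{\geqslant1}$ is admissible if it is nondecreasing, doubling ($\limsup_{r\to+\infty}u(2r)/u(r)<+\infty$) and sublinear ($u(r)/r\to0$ as $r\to+\infty$). A map $f:X\to Y$ is a $(\underline{\lambda},\overline{\lambda},O(u))$-sublinearly biLipschitz equivalence if there is a nondecreasing function $w=O(u)$ such that for all $x,x'\in X$, $\underline{\lambda}|x-x'|-w(|x|\vee|x'|)\leqslant|f(x)-f(x')|\leqslant\overline{\lambda}|x-x'|+w(|x|\vee|x'|)$, and for all $y\in Y$, $d(y,f(X))\leqslant w(|y|)$. Gromov product: $(x\mid y)_o=\frac12(|x-o|+|y-o|-|x-y|)$. A metric space is $\delta$-hyperbolic if $(x_1\mid x_3)_{x_0}\geqslant\min\{(x_1\mid x_2)_{x_0},(x_2\mid x_3)_{x_0}\}-\delta$ for all $x_0,\dots,x_3$, and hyperbolic if it is $\delta$-hyperbolic for some $\delta\geqslant0$. The boundary $\partial_\infty X$ of a proper geodesic hyperbolic space is the set of sequences $(x_n)$ with $(x_n\mid x_m)_o\to+\infty$ as $n,m\to\infty$, modulo $(x_n)\sim(y_n)$ iff $(x_n\mid y_n)_o\to+\infty$. The map induced by $f$ sends the class of $(x_n)$ to the class of $(f(x_n))$. For $\xi,\eta\in\partial_\infty X$, $(\xi\mid\eta)_o=\inf\liminf_n(x_n\mid y_n)_o$ over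 sequences representing $\xi$ and $\eta$. Fix $\delta\geqslant 0$ such that both $X$ and $Y$ are $\delta$-hyperbolic, and set $\mu=2^{1/\delta}$ if $\delta>0$, $\mu=e$ if $\delta=0$. The visual distance $d_\mu$ on the boundary is $d_\mu(\xi,\xi')=\inf\{\sum_{i=1}^n\mu^{-(\xi_{i-1}\mid\xi_i)_o}: n\geqslant1,\ \xi_0=\xi,\ \xi_n=\xi'\}$; it satisfies $d_\mu(\xi,\xi')\leqslant\mu^{-(\xi\mid\xi')_o}\leqslant4d_\mu(\xi,\xi')$. The cross-ratio of distinct points is $$[\xi_1,\xi_2,\xi_3,\xi_4]=\frac{d_\mu(\xi_1,\xi_3)\,d_\mu(\xi_2,\xi_4)}{d_\mu(\xi_1,\xi_4)\,d_\mu(\xi_2,\xi_3)}.$$ Here $\log$ means $\log_\mu$, $\log^+(s)=\max(0,\log s)$, and $\overline{\boxtimes}\{\xi_i\}=\sup_{i\neq j}(\xi_i\mid\xi_j)_o$. *)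

theory Defs
  imports "HOL-Analysis.Analysis" "HOL-Library.Landau_Symbols"
begin

definition admissible :: "(real \<Rightarrow> real) \<Rightarrow> bool" where
  "admissible u \<longleftrightarrow>
     (\<forall>r\<ge>0. u r \<ge> 1) \<and> mono_on {0..} u \<and>
     Limsup at_top (\<lambda>r. ereal (u (2 * r) / u r)) < \<infinity> \<and>
     ((\<lambda>r. u r / r) \<longlongrightarrow> 0) at_top"

text \<open>The values of \<open>u\<close>, \<open>w\<close> at negative arguments are irrelevant: these functions live on
  \<open>{0..}\<close>. The parameters \<open>p\<close>, \<open>q\<close> are the base-points of the source and of the target.\<close>

definition SBE ::
  "'a::metric_space \<Rightarrow> 'b::metric_space \<Rightarrow> real \<Rightarrow> real \<Rightarrow> (real \<Rightarrow> real) \<Rightarrow> ('a \<Rightarrow> 'b) \<Rightarrow> bool" where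
  "SBE p q l L u f \<longleftrightarrow>
     (\<exists>w :: real \<Rightarrow> real. mono_on {0..} w \<and> w \<in> O[at_top](u) \<and>
        (\<forall>x x'. l * dist x x' - w (max (dist p x) (dist p x')) \<le> dist (f x) (f x') \<and>
                dist (f x) (f x') \<le> L * dist x x' + w (max (dist p x) (dist p x'))) \<and>
        (\<forall>y. infdist y (range f) \<le> w (dist q y)))"

definition proper_space :: "'a::metric_space itself \<Rightarrow> bool" where
  "proper_space _ \<longleftrightarrow> (\<forall>(x::'a) r. compact (cball x r))"

definition geodesic_space :: "'a::metric_space itself \<Rightarrow> bool" where
  "geodesic_space _ \<longleftrightarrow>
     (\<forall>x y :: 'a. \<exists>g :: real \<Rightarrow> 'a. g 0 = x \<and> g (dist x y) = y \<and>
        (\<forall>s\<in>{0..dist x y}. \<forall>t\<in>{0..dist x y}. dist (g s) (g t) = \<bar>s - t\<bar>))"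

definition gromov_product :: "'a::metric_space \<Rightarrow> 'a \<Rightarrow> 'a \<Rightarrow> real" where
  "gromov_product p x y = (dist x p + dist y p - dist x y) / 2"

definition delta_hyperbolic :: "'a::metric_space itself \<Rightarrow> real \<Rightarrow> bool" where
  "delta_hyperbolic _ \<delta> \<longleftrightarrow>
     (\<forall>x0 x1 x2 x3 :: 'a.
        gromov_product x0 x1 x3 \<ge>
          min (gromov_product x0 x1 x2) (gromov_product x0 x2 x3) - \<delta>)"

definition gromov_seq :: "'a::metric_space \<Rightarrow> (nat \<Rightarrow> 'a) \<Rightarrow> bool" where
  "gromov_seq p x \<longleftrightarrow>
     filterlim (\<lambda>(n, m). gromov_product p (x n) (x m)) at_top (sequentially \<times>\<^sub>F sequentially)"

definition gromov_rel :: "'a::metric_space \<Rightarrow> ((nat \<Rightarrow> 'a) \<times> (nat \<Rightarrow> 'a)) set" where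
  "gromov_rel p =
     {(x, y). gromov_seq p x \<and> gromov_seq p y \<and>
        filterlim (\<lambda>n. gromov_product p (x n) (y n)) at_top sequentially}"

definition boundary :: "'a::metric_space \<Rightarrow> (nat \<Rightarrow> 'a) set set" where
  "boundary p = {x. gromov_seq p x} // gromov_rel p"

definition induces_boundary_map ::
  "'a::metric_space \<Rightarrow> 'b::metric_space \<Rightarrow> ('a \<Rightarrow> 'b) \<Rightarrow>
     ((nat \<Rightarrow> 'a) set \<Rightarrow> (nat \<Rightarrow> 'b) set) \<Rightarrow> bool" where
  "induces_boundary_map p q f \<phi> \<longleftrightarrow>
     \<phi> \<in> boundary p \<rightarrow> boundary q \<and>
     (\<forall>x. gromov_seq p x \<longrightarrow>
        gromov_seq q (f \<circ> x) \<and> \<phi> (gromov_rel p `` {x}) = gromov_rel q `` {f \<circ> x})"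

text \<open>The product of a boundary point with itself is \<open>\<infinity>\<close>, hence the extended reals.\<close>

definition boundary_product ::
  "'a::metric_space \<Rightarrow> (nat \<Rightarrow> 'a) set \<Rightarrow> (nat \<Rightarrow> 'a) set \<Rightarrow> ereal" where
  "boundary_product p \<xi> \<eta> =
     (INF (x, y)\<in>\<xi> \<times> \<eta>. liminf (\<lambda>n. ereal (gromov_product p (x n) (y n))))"

definition visual_base :: "real \<Rightarrow> real" where
  "visual_base \<delta> = (if \<delta> > 0 then 2 powr (1 / \<delta>) else exp 1)"

text \<open>\<open>\<mu>\<close> to the power \<open>- (\<xi> | \<eta>)\<close>, with value 0 when the product is \<open>\<infinity>\<close>.\<close>

definition visual_weight ::
  "'a::metric_space \<Rightarrow> real \<Rightarrow> (nat \<Rightarrow> 'a) set \<Rightarrow> (nat \<Rightarrow> 'a) set \<Rightarrow> real" where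
  "visual_weight p \<mu> \<xi> \<eta> =
     (if boundary_product p \<xi> \<eta> = \<infinity> then 0
      else \<mu> powr (- real_of_ereal (boundary_product p \<xi> \<eta>)))"

definition visual_dist ::
  "'a::metric_space \<Rightarrow> real \<Rightarrow> (nat \<Rightarrow> 'a) set \<Rightarrow> (nat \<Rightarrow> 'a) set \<Rightarrow> real" where
  "visual_dist p \<mu> \<xi> \<xi>' =
     Inf {(\<Sum>i=1..n. visual_weight p \<mu> (\<zeta> (i - 1)) (\<zeta> i)) | (n::nat) \<zeta>.
            n \<ge> 1 \<and> \<zeta> 0 = \<xi> \<and> \<zeta> n = \<xi>' \<and> (\<forall>i\<le>n. \<zeta> i \<in> boundary p)}"

definition cross_ratio ::
  "'a::metric_space \<Rightarrow> real \<Rightarrow> (nat \<Rightarrow> 'a) set \<Rightarrow> (nat \<Rightarrow> 'a) set \<Rightarrow>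
     (nat \<Rightarrow> 'a) set \<Rightarrow> (nat \<Rightarrow> 'a) set \<Rightarrow> real" where
  "cross_ratio p \<mu> \<xi>1 \<xi>2 \<xi>3 \<xi>4 =
     (visual_dist p \<mu> \<xi>1 \<xi>3 * visual_dist p \<mu> \<xi>2 \<xi>4) /
     (visual_dist p \<mu> \<xi>1 \<xi>4 * visual_dist p \<mu> \<xi>2 \<xi>3)"

definition log_plus :: "real \<Rightarrow> real \<Rightarrow> real" where
  "log_plus \<mu> s = max 0 (log \<mu> s)"

text \<open>For a finite family of at least two pairwise distinct boundary points the supremum is finite,
  so that passing to the reals loses nothing.\<close>

definition sup_product ::
  "'a::metric_space \<Rightarrow> nat set \<Rightarrow> (nat \<Rightarrow> (nat \<Rightarrow> 'a) set) \<Rightarrow> real" where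
  "sup_product p I \<xi> =
     real_of_ereal (SUP (i, j)\<in>{(i, j). i \<in> I \<and> j \<in> I \<and> i \<noteq> j}. boundary_product p (\<xi> i) (\<xi> j))"

end

theory Submission
  imports Defs
begin

text \<open>
  Up to bounded errors the logarithm of the cross-ratio of four boundary points is a combination of
  four Gromov products (\<open>log_cross_ratio\<close>), and these are approximated by the products of points of
  the space far out along representing sequences (\<open>boundary_product_approx\<close>). The combination of
  products does not depend on the base-point; for points of the space it is the cross-difference
  \<open>(d(x1, x3) + d(x2, x4) - d(x1, x4) - d(x2, x3)) / 2\<close>. In a tree, its positive part is the distance
  between the geodesics \<open>[x1, x4]\<close> and \<open>[x2, x3]\<close>, that is, the length of the bridge that joins the two
  branch points of the quadrilateral. So the theorem says that \<open>f\<close> distorts the length of this bridge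
  by the factors \<open>l\<close> and \<open>L\<close>, up to an error of order \<open>u\<close>. The defining inequality of \<open>f\<close> gives
  exactly this for the images of the two branch points, whose distance from the base-point is at most
  the largest product of the four points plus a constant.

  It remains to see that \<open>f\<close> maps branch points to approximate branch points. This is a stability
  statement for geodesics (\<open>sublinear_stability\<close>): if \<open>m\<close> lies on a geodesic from \<open>x\<close> to \<open>y\<close>, then the
  product of \<open>f x\<close> and \<open>f y\<close> at \<open>f m\<close> is \<open>O(u |m|)\<close>, uniformly in \<open>x\<close> and \<open>y\<close>. Doubling and
  sublinearity give \<open>u (r + t) \<le> C u r + \<epsilon> t\<close> for every \<open>\<epsilon> > 0\<close> (\<open>admissible_absorb\<close>), so along the
  geodesic the map is a quasi-isometric embedding whose additive error is \<open>O(u |m|)\<close> at \<open>m\<close> and grows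
  at an arbitrarily small linear rate away from \<open>m\<close>. For such tapered quasi-geodesics stability at the
  centre follows from the usual Morse lemma, applied at all dyadic scales, as soon as the rate is
  small compared with the Morse constant (\<open>tapered_quasi_geodesic_stability\<close>). The Morse lemma itself
  (\<open>quasi_geodesic_stability\<close>) is proved with an error proportional to the additive constant of the
  quasi-geodesic, provided that this constant is at least \<open>\<delta>\<close>, by comparing with chains of points
  along the path.

  The same stability statement shows that products of images tend to infinity with the products of
  the points and stay bounded with them (\<open>SBE_product_bounds\<close>), which makes the boundary map well
  defined and injective. On the side of the visual distance, the base \<open>\<mu>\<close> is chosen such that
  \<open>\<mu>\<close> to the power \<open>- (\<xi> | \<eta>)\<close> is a quasi-ultrametric with constant 2, for which the chain infimum
  loses at most the factor 4 (\<open>chain_inequality\<close>).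
\<close>

section \<open>Gromov products in hyperbolic spaces\<close>

abbreviation gp :: "'a::metric_space \<Rightarrow> 'a \<Rightarrow> 'a \<Rightarrow> real" where
  "gp \<equiv> gromov_product"

lemma gp_commute: "gp z x y = gp z y x"
  by (simp add: gromov_product_def dist_commute)

lemma gp_nonneg: "0 \<le> gp z x y"
  using dist_triangle3[of x y z] by (simp add: gromov_product_def dist_commute)

lemma gp_self: "gp z x x = dist z x"
  by (simp add: gromov_product_def dist_commute)

lemma gp_le_dist: "gp z x y \<le> dist z x" "gp z x y \<le> dist z y"
  using dist_triangle[of y z x] dist_triangle[of x z y]
  by (simp_all add: gromov_product_def dist_commute)

lemma gp_ge_dist_diff: "dist z x - dist x y \<le> gp z x y"
  using dist_triangle[of z x y] by (simp add: gromov_product_def dist_commute)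

lemma gp_change_base: "gp z x y \<le> gp z' x y + dist z z'"
  using dist_triangle[of x z z'] dist_triangle[of y z z']
  by (simp add: gromov_product_def dist_commute field_simps)

text \<open>Moving the base-point from \<open>z\<close> to \<open>m\<close>. If the three products at \<open>m\<close> are small, then \<open>m\<close> is
  an approximate centre of the triangle \<open>z, x, y\<close> and the product at \<open>z\<close> is the distance to \<open>m\<close>, up
  to these three products.\<close>

lemma gp_through: "gp z x y = dist z m - gp m z x - gp m z y + gp m x y"
  by (simp add: gromov_product_def dist_commute field_simps)

lemma gp_add_gp: "gp x m y + gp m x y = dist x m"
  by (simp add: gromov_product_def dist_commute field_simps)

lemma hyperbolicD:
  assumes "delta_hyperbolic TYPE('a::metric_space) \<delta>"
  shows "min (gp z x y) (gp z y w) - \<delta> \<le> gp z (x::'a) w"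
  using assms by (simp add: delta_hyperbolic_def)

lemma hyperbolic_constant_nonneg:
  assumes "delta_hyperbolic TYPE('a::metric_space) \<delta>"
  shows "0 \<le> \<delta>"
  using hyperbolicD[OF assms, of undefined undefined undefined undefined]
  by (simp add: gp_self)

lemma hyperbolicD2:
  assumes "delta_hyperbolic TYPE('a::metric_space) \<delta>"
  shows "min (gp z x y) (min (gp z y y') (gp z y' w)) - 2 * \<delta> \<le> gp z (x::'a) w"
  using hyperbolicD[OF assms, of z x y w] hyperbolicD[OF assms, of z y y' w]
    hyperbolic_constant_nonneg[OF assms]
  by (auto simp: min_def split: if_splits)

text \<open>Halving the chain loses \<open>\<delta>\<close> once per level, so the loss is logarithmic in the number of
  links. So a path that avoids a large ball around a point between its ends is exponentially long.\<close>

lemma gp_chain: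
  assumes hyp: "delta_hyperbolic TYPE('a::metric_space) \<delta>"
    and "1 \<le> n" "n \<le> 2 ^ k" and "\<And>i. i < n \<Longrightarrow> c \<le> gp z (x i) (x (Suc i) :: 'a)"
  shows "c - real k * \<delta> \<le> gp z (x 0) (x n)"
  using assms(2-)
proof (induction k arbitrary: n x)
  case 0
  then have "n = 1" by simp
  then show ?case using 0(3)[of 0] by simp
next
  case (Suc k)
  show ?case
  proof (cases "n \<le> 2 ^ k")
    case True
    have "c - real k * \<delta> \<le> gp z (x 0) (x n)" by (rule Suc.IH) (use Suc True in auto)
    then show ?thesis using hyperbolic_constant_nonneg[OF hyp] by (simp add: field_simps)
  next
    case False
    have 1: "c - real k * \<delta> \<le> gp z (x 0) (x (2 ^ k))"
      by (rule Suc.IH) (use Suc False in auto)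
    have "c - real k * \<delta> \<le> gp z (x (2 ^ k + 0)) (x (2 ^ k + (n - 2 ^ k)))"
      by (rule Suc.IH[where x="\<lambda>i. x (2 ^ k + i)"]) (use Suc False in auto)
    then have 2: "c - real k * \<delta> \<le> gp z (x (2 ^ k)) (x n)" using False by simp
    show ?thesis using 1 2 hyperbolicD[OF hyp, of z "x 0" "x (2 ^ k)" "x n"]
      by (simp add: field_simps)
  qed
qed

definition geodesic_path :: "(real \<Rightarrow> 'a::metric_space) \<Rightarrow> 'a \<Rightarrow> 'a \<Rightarrow> bool" where
  "geodesic_path g x y \<longleftrightarrow> g 0 = x \<and> g (dist x y) = y \<and>
     (\<forall>s\<in>{0..dist x y}. \<forall>t\<in>{0..dist x y}. dist (g s) (g t) = \<bar>s - t\<bar>)"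

lemma geodesic_pathE:
  assumes "geodesic_space TYPE('a::metric_space)"
  obtains g where "geodesic_path g (x::'a) y"
  using assms unfolding geodesic_space_def geodesic_path_def by blast

lemma geodesic_path_dist:
  assumes "geodesic_path g x y" "s \<in> {0..dist x y}" "t \<in> {0..dist x y}"
  shows "dist (g s) (g t) = \<bar>s - t\<bar>"
  using assms by (auto simp: geodesic_path_def)

lemma geodesic_path_gp:
  assumes g: "geodesic_path g x y" and "0 \<le> r" "r \<le> s" "s \<le> t" "t \<le> dist x y"
  shows "gp (g s) (g r) (g t) = 0"
  using assms geodesic_path_dist[OF g, of r s] geodesic_path_dist[OF g, of s t]
    geodesic_path_dist[OF g, of r t]
  by (simp add: gromov_product_def dist_commute)

lemma tripod_centre:
  assumes hyp: "delta_hyperbolic TYPE('a::metric_space) \<delta>"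
    and g: "geodesic_path g (x::'a) y" and m: "m = g (gp x y z)"
  shows "gp m x y = 0" "gp m x z \<le> \<delta>" "gp m y z \<le> \<delta>"
proof -
  let ?t = "gp x y z"
  have t: "0 \<le> ?t" "?t \<le> dist x y" by (auto simp: gp_nonneg gp_le_dist)
  have gx: "g 0 = x" and gy: "g (dist x y) = y" using g by (auto simp: geodesic_path_def)
  have mx: "dist m x = ?t"
    using geodesic_path_dist[OF g, of 0 ?t] t by (simp add: gx m dist_commute)
  have my: "dist m y = dist x y - ?t"
    using geodesic_path_dist[OF g, of "dist x y" ?t] t by (simp add: gy m dist_commute)
  show 0: "gp m x y = 0" using mx my by (simp add: gromov_product_def dist_commute)
  \<comment> \<open>The parameter of the centre equates its two products with \<open>z\<close>, and their minimum is small.\<close>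
  have "gp m x z = gp m y z" using mx my by (simp add: gromov_product_def dist_commute field_simps)
  then show "gp m x z \<le> \<delta>" "gp m y z \<le> \<delta>"
    using hyperbolicD[OF hyp, of m x z y] 0 by (auto simp: gp_commute)
qed

section \<open>Stability of quasi-geodesics\<close>

text \<open>Such a path may be discontinuous: the image of a geodesic under a sublinearly biLipschitz map
  can jump by about the additive constant \<open>A\<close>.\<close>

definition quasi_geodesic_on ::
  "real \<Rightarrow> real \<Rightarrow> real \<Rightarrow> real set \<Rightarrow> (real \<Rightarrow> 'a::metric_space) \<Rightarrow> bool" where
  "quasi_geodesic_on l L A S F \<longleftrightarrow>
     (\<forall>s\<in>S. \<forall>t\<in>S. l * \<bar>s - t\<bar> - A \<le> dist (F s) (F t) \<and> dist (F s) (F t) \<le> L * \<bar>s - t\<bar> + A)"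

lemma quasi_geodesic_onD:
  assumes "quasi_geodesic_on l L A S F" "s \<in> S" "t \<in> S"
  shows "l * \<bar>s - t\<bar> - A \<le> dist (F s) (F t)" "dist (F s) (F t) \<le> L * \<bar>s - t\<bar> + A"
  using assms unfolding quasi_geodesic_on_def by auto

lemma subdivided_segment:
  fixes s s' h :: real
  assumes "0 < h"
  obtains n \<tau> where "1 \<le> n" "real n \<le> \<bar>s - s'\<bar> / h + 2" "\<tau> 0 = s" "\<tau> n = s'"
    "\<And>i. i < n \<Longrightarrow> \<bar>\<tau> i - \<tau> (Suc i)\<bar> \<le> h"
    "\<And>i. i \<le> n \<Longrightarrow> \<tau> i \<in> {min s s'..max s s'}"
proof -
  define n where "n = nat \<lfloor>\<bar>s - s'\<bar> / h\<rfloor> + 1"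
  have q: "0 \<le> \<bar>s - s'\<bar> / h" using assms by simp
  have n1: "1 \<le> n" by (simp add: n_def)
  have n2: "real n \<le> \<bar>s - s'\<bar> / h + 2"
    using q of_int_floor_le[of "\<bar>s - s'\<bar> / h"] unfolding n_def by simp linarith
  have "\<bar>s - s'\<bar> / h < real n"
    using q unfolding n_def by simp linarith
  then have n3: "\<bar>s - s'\<bar> / real n \<le> h"
    using assms n1 by (simp add: field_simps)
  define \<tau> where "\<tau> i = s + (real i / real n) * (s' - s)" for i
  have "\<bar>\<tau> i - \<tau> (Suc i)\<bar> = \<bar>s - s'\<bar> / real n" for i
  proof -
    have "\<tau> i - \<tau> (Suc i) = (s - s') / real n" using n1 by (simp add: \<tau>_def field_simps)
    then show ?thesis using n1 by simp
  qed
  moreover have "\<tau> i \<in> {min s s'..max s s'}" if "i \<le> n" for i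
  proof -
    define \<theta> where "\<theta> = real i / real n"
    have \<theta>: "0 \<le> \<theta>" "\<theta> \<le> 1" using that n1 by (auto simp: \<theta>_def)
    have "\<tau> i = (1 - \<theta>) * s + \<theta> * s'" unfolding \<tau>_def \<theta>_def by algebra
    moreover have "(1 - \<theta>) * s + \<theta> * s' \<le> max s s'"
      using \<theta> by (intro convex_bound_le) auto
    moreover have "min s s' \<le> (1 - \<theta>) * s + \<theta> * s'"
      using convex_bound_le[of "-s" "- min s s'" "-s'" "1-\<theta>" \<theta>] \<theta> by auto
    ultimately show ?thesis by auto
  qed
  moreover have "\<tau> 0 = s" "\<tau> n = s'" using n1 by (auto simp: \<tau>_def)
  ultimately show ?thesis using that[of n \<tau>] n1 n2 n3 by auto
qed

lemma exponential_beats_affine: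
  fixes \<alpha> \<beta> :: real
  obtains k0 :: nat where "\<And>k. k0 < k \<Longrightarrow> \<alpha> + \<beta> * real k < 2 ^ k"
proof -
  have "(\<lambda>k::nat. (1/2::real) ^ k * (\<alpha> + \<beta> * real k)) \<longlonglongrightarrow> 0"
  proof -
    have "(\<lambda>k::nat. \<alpha> * (1/2::real) ^ k + \<beta> * (real k * (1/2) ^ k)) \<longlonglongrightarrow> \<alpha> * 0 + \<beta> * 0"
      by (intro tendsto_intros powser_times_n_limit_0 LIMSEQ_power_zero) auto
    then show ?thesis by (simp add: algebra_simps)
  qed
  then have "eventually (\<lambda>k. (1/2::real) ^ k * (\<alpha> + \<beta> * real k) < 1) sequentially"
    by (rule order_tendstoD) simp
  then obtain k0 where k0: "\<And>k. k0 \<le> k \<Longrightarrow> (1/2::real) ^ k * (\<alpha> + \<beta> * real k) < 1"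
    by (auto simp: eventually_sequentially)
  show ?thesis
    by (rule that[of k0]) (use k0 in \<open>auto simp: field_simps power_one_over\<close>)
qed

lemma infdist_lessE:
  assumes "S \<noteq> {}" "infdist x S < c"
  obtains y where "y \<in> S" "dist x y < c"
  by (metis assms cINF_less_iff bdd_below_image_dist infdist_notempty)

text \<open>The geodesic stays close to the quasi-geodesic with the same ends. Let \<open>z\<close> be the point of the
  geodesic that is farthest from the path, at distance \<open>D\<close>. Leave the geodesic at distance about
  \<open>2 D\<close> on both sides of \<open>z\<close>, jump to the path, and follow it in steps of size \<open>A\<close>. This detour has
  \<open>O(D / A)\<close> links, and each has a product at least \<open>D - O(A)\<close> as seen from \<open>z\<close>, whereas its two
  ends have product 0 because \<open>z\<close> lies between them on the geodesic. So \<open>gp_chain\<close> gives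
  \<open>D / A \<le> O(1) + log\<^sub>2 O(1 + D / A)\<close>, hence a bound on \<open>D / A\<close>. The hypothesis \<open>\<delta> \<le> A\<close> lets the
  bound depend on \<open>l\<close> and \<open>L\<close> only; this scaling is essential later, where \<open>A\<close> grows with the
  distance to the base-point.\<close>

lemma geodesic_near_quasi_geodesic:
  fixes l L :: real
  assumes l: "0 < l" and L: "0 \<le> L"
  obtains M where "0 \<le> M"
    "\<And>(F :: real \<Rightarrow> 'a::metric_space) a b A \<delta> g t. \<lbrakk>delta_hyperbolic TYPE('a) \<delta>; \<delta> \<le> A; 0 < A; a \<le> b;
        quasi_geodesic_on l L A {a..b} F; geodesic_path g (F a) (F b); 0 \<le> t; t \<le> dist (F a) (F b)\<rbrakk>
      \<Longrightarrow> infdist (g t) (F ` {a..b}) \<le> M * A"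
proof -
  \<comment> \<open>If \<open>D / A \<le> L + 2 + k\<close>, the affine function bounds the number of links of the detour.\<close>
  obtain k0 where k0: "\<And>k. k0 < k \<Longrightarrow> (4 + (7 + 6 * (L + 2)) / l) + (6 / l) * real k < 2 ^ k"
    using exponential_beats_affine[of "4 + (7 + 6 * (L + 2)) / l" "6 / l"] by blast
  define M where "M = L + 2 + real k0"
  have "infdist (g t) (F ` {a..b}) \<le> M * A"
    if hyp: "delta_hyperbolic TYPE('a) \<delta>" and \<delta>: "\<delta> \<le> A" and A: "0 < A" and ab: "a \<le> b"
      and F: "quasi_geodesic_on l L A {a..b} F" and g: "geodesic_path g (F a) (F b)"
      and t: "0 \<le> t" "t \<le> dist (F a) (F b)"
    for F :: "real \<Rightarrow> 'a" and a b A \<delta> g t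
  proof -
    define P where "P = F ` {a..b}"
    define d where "d = dist (F a) (F b)"
    have P: "P \<noteq> {}" "F a \<in> P" "F b \<in> P" using ab by (auto simp: P_def)
    have g0: "g 0 = F a" and gd: "g d = F b" using g by (auto simp: geodesic_path_def d_def)
    have gdist: "dist (g r) (g s) = \<bar>r - s\<bar>" if "r \<in> {0..d}" "s \<in> {0..d}" for r s
      using geodesic_path_dist[OF g] that by (simp add: d_def)
    have "continuous_on {0..d} g"
      by (rule lipschitz_on_continuous_on[of 1], rule lipschitz_onI)
         (use gdist in \<open>auto simp: dist_real_def\<close>)
    then have "continuous_on {0..d} (\<lambda>r. infdist (g r) P)"
      by (intro continuous_on_infdist)
    then obtain t0 where t0: "t0 \<in> {0..d}" "\<And>r. r \<in> {0..d} \<Longrightarrow> infdist (g r) P \<le> infdist (g t0) P"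
      using continuous_attains_sup[of "{0..d}" "\<lambda>r. infdist (g r) P"] t by (auto simp: d_def)
    define D where "D = infdist (g t0) P"
    define z where "z = g t0"
    have D0: "0 \<le> D" by (simp add: D_def infdist_nonneg)
    have zP: "D \<le> dist z y" if "y \<in> P" for y using infdist_le[OF that] by (simp add: D_def z_def)
    \<comment> \<open>Flank the worst point at distance \<open>2 (D + A)\<close>, or by an end of the geodesic when it is
      nearer; the parameter of the path point chosen near a flank keeps all links far from \<open>z\<close>.\<close>
    have flank: "\<exists>s\<in>{a..b}. dist (g r) (F s) \<le> D + A \<and> D \<le> gp z (g r) (F s)"
      if r: "r \<in> {0..d}" and far: "r = 0 \<or> r = d \<or> \<bar>t0 - r\<bar> = 2 * (D + A)" for r
    proof -
      consider "r = 0" | "r = d" | "\<bar>t0 - r\<bar> = 2 * (D + A)" using far by blast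
      then show ?thesis
      proof cases
        case 1
        then show ?thesis using ab D0 A zP[OF P(2)] by (intro bexI[of _ a]) (auto simp: g0 gp_self)
      next
        case 2
        then show ?thesis using ab D0 A zP[OF P(3)] by (intro bexI[of _ b]) (auto simp: gd gp_self)
      next
        case 3
        have "infdist (g r) P < D + A" using t0(2)[OF r] A by (simp add: D_def)
        then obtain y where y: "y \<in> P" "dist (g r) y < D + A"
          using infdist_lessE[OF P(1)] by blast
        then obtain s where s: "s \<in> {a..b}" "y = F s" by (auto simp: P_def)
        have "dist z (g r) = 2 * (D + A)" using 3 gdist[OF t0(1) r] by (simp add: z_def)
        then show ?thesis using s y gp_ge_dist_diff[of z "g r" y] A by (intro bexI[of _ s]) auto
      qed
    qed
    define t1 where "t1 = max 0 (t0 - 2 * (D + A))"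
    define t2 where "t2 = min d (t0 + 2 * (D + A))"
    have t12: "t1 \<in> {0..d}" "t2 \<in> {0..d}" "t1 \<le> t0" "t0 \<le> t2" "t2 - t1 \<le> 4 * (D + A)"
      using t0(1) D0 A by (auto simp: t1_def t2_def)
    have "t1 = 0 \<or> t1 = d \<or> \<bar>t0 - t1\<bar> = 2 * (D + A)" "t2 = 0 \<or> t2 = d \<or> \<bar>t0 - t2\<bar> = 2 * (D + A)"
      using D0 A by (auto simp: t1_def t2_def)
    then obtain s1 s2 where s1: "s1 \<in> {a..b}" "dist (g t1) (F s1) \<le> D + A" "D \<le> gp z (g t1) (F s1)"
      and s2: "s2 \<in> {a..b}" "dist (g t2) (F s2) \<le> D + A" "D \<le> gp z (g t2) (F s2)"
      using flank[OF t12(1)] flank[OF t12(2)] by blast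
    have "dist (F s1) (F s2) \<le> dist (F s1) (g t1) + dist (g t1) (g t2) + dist (g t2) (F s2)"
      by metric
    also have "\<dots> \<le> (D + A) + 4 * (D + A) + (D + A)"
      using s1 s2 gdist[OF t12(1,2)] t12 by (simp add: dist_commute)
    finally have "l * \<bar>s1 - s2\<bar> - A \<le> 6 * (D + A)"
      using F s1 s2 unfolding quasi_geodesic_on_def by fastforce
    then have s12: "\<bar>s1 - s2\<bar> \<le> (7 * A + 6 * D) / l" using l by (simp add: field_simps)
    obtain n \<tau> where n: "1 \<le> n" "real n \<le> \<bar>s1 - s2\<bar> / A + 2" and \<tau>: "\<tau> 0 = s1" "\<tau> n = s2"
      "\<And>i. i < n \<Longrightarrow> \<bar>\<tau> i - \<tau> (Suc i)\<bar> \<le> A" "\<And>i. i \<le> n \<Longrightarrow> \<tau> i \<in> {min s1 s2..max s1 s2}"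
      using subdivided_segment[OF A] by metis
    have \<tau>ab: "\<tau> i \<in> {a..b}" if "i \<le> n" for i
      using \<tau>(4)[OF that] s1(1) s2(1) by auto
    define x where "x i = (if i = 0 then g t1 else if i \<le> n + 1 then F (\<tau> (i - 1)) else g t2)" for i
    have link: "D - (L + 1) * A \<le> gp z (x i) (x (Suc i))" if "i < n + 2" for i
    proof -
      have LA: "0 \<le> (L + 1) * A" using L A by simp
      consider "i = 0" | "0 < i" "i \<le> n" | "i = n + 1" using \<open>i < n + 2\<close> by linarith
      then show ?thesis
      proof cases
        case 1
        then show ?thesis using s1(3) LA by (simp add: x_def \<tau>)
      next
        case 2
        have xi: "x i = F (\<tau> (i - 1))" "x (Suc i) = F (\<tau> i)" using 2 by (auto simp: x_def)
        have m: "i - 1 \<le> n" "i \<le> n" "i - 1 < n" using 2 by auto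
        have "\<bar>\<tau> (i - 1) - \<tau> i\<bar> \<le> A" using \<tau>(3)[OF m(3)] 2 by simp
        then have "L * \<bar>\<tau> (i - 1) - \<tau> i\<bar> \<le> L * A" using L by (simp add: mult_left_mono)
        then have "dist (x i) (x (Suc i)) \<le> (L + 1) * A"
          using F \<tau>ab[OF m(1)] \<tau>ab[OF m(2)] unfolding xi quasi_geodesic_on_def
          by (fastforce simp: algebra_simps)
        moreover have "D \<le> dist z (x i)" by (rule zP) (use \<tau>ab[OF m(1)] xi in \<open>auto simp: P_def\<close>)
        ultimately show ?thesis using gp_ge_dist_diff[of z "x i" "x (Suc i)"] by linarith
      next
        case 3
        then show ?thesis using s2(3) LA by (simp add: x_def \<tau> gp_commute)
      qed
    qed
    have x_ends: "x 0 = g t1" "x (n + 2) = g t2" by (auto simp: x_def)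
    have gp0: "gp z (g t1) (g t2) = 0"
      using geodesic_path_gp[OF g, of t1 t0 t2] t12 t0 by (simp add: z_def d_def)
    have "D \<le> M * A"
    proof (rule ccontr)
      assume big: "\<not> D \<le> M * A"
      define X where "X = D / A"
      have DX: "D = X * A" using A by (simp add: X_def)
      have XM: "M < X" using big A by (simp add: DX)
      \<comment> \<open>The largest number of halvings for which \<open>gp_chain\<close> would contradict the product 0 of the
        two ends: the chain must have more than \<open>2 ^ k\<close> links.\<close>
      define k where "k = nat (\<lceil>X - L - 1\<rceil> - 1)"
      have k: "real k < X - L - 1" "X - L - 2 \<le> real k" "k0 < k"
        using XM unfolding k_def M_def by linarith+
      have "\<not> n + 2 \<le> 2 ^ k"
      proof
        assume "n + 2 \<le> 2 ^ k"
        then have "D - (L + 1) * A - real k * \<delta> \<le> gp z (x 0) (x (n + 2))"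
          by (intro gp_chain[OF hyp, where x=x]) (use link in auto)
        then have "D - (L + 1) * A \<le> real k * \<delta>" unfolding x_ends gp0 by simp
        also have "\<dots> \<le> real k * A" using \<delta> by (simp add: mult_left_mono)
        finally have "(X - L - 1 - real k) * A \<le> 0" by (simp add: DX algebra_simps)
        then show False using k(1) A by (simp add: mult_le_0_iff)
      qed
      then have "2 ^ k \<le> real n + 2"
        by (metis nat_le_linear of_nat_add of_nat_le_iff of_nat_numeral of_nat_power)
      also have "\<dots> \<le> \<bar>s1 - s2\<bar> / A + 4" using n by simp
      also have "\<dots> \<le> (7 * A + 6 * D) / l / A + 4"
        using divide_right_mono[OF s12, of A] A by linarith
      also have "\<dots> = (7 + 6 * X) / l + 4" using A l by (simp add: DX field_simps)
      also have "\<dots> \<le> (7 + 6 * (L + 2 + real k)) / l + 4"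
        using k(2) l by (simp add: divide_right_mono)
      also have "\<dots> = (4 + (7 + 6 * (L + 2)) / l) + (6 / l) * real k"
        using l by (simp add: field_simps)
      finally show False using k0[OF k(3)] by simp
    qed
    moreover have "infdist (g t) P \<le> D" using t0(2)[of t] t by (simp add: D_def d_def)
    ultimately show ?thesis by (simp add: P_def)
  qed
  moreover have "0 \<le> M" using L by (simp add: M_def)
  ultimately show ?thesis using that by blast
qed

text \<open>The converse closeness, in the form of a small product at a point \<open>F c\<close> of the path. Every
  point of the geodesic is close to the left or to the right part of the path. Both alternatives are
  closed conditions and both occur, so by connectedness some point of the geodesic is close to
  \<open>F s\<close> and to \<open>F s'\<close> with \<open>s \<le> c \<le> s'\<close>. Then \<open>s' - s\<close> is \<open>O(A)\<close>, so \<open>F c\<close> is close to that point.\<close>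

lemma quasi_geodesic_stability:
  fixes l L :: real
  assumes l: "0 < l" and L: "0 \<le> L" and geod: "geodesic_space TYPE('a::metric_space)"
  obtains M where "0 \<le> M"
    "\<And>(F :: real \<Rightarrow> 'a) a b c A \<delta>. \<lbrakk>delta_hyperbolic TYPE('a) \<delta>; \<delta> \<le> A; 0 < A;
        a \<le> c; c \<le> b; quasi_geodesic_on l L A {a..b} F\<rbrakk>
      \<Longrightarrow> gp (F c) (F a) (F b) \<le> M * A"
proof -
  obtain M0 where M0: "0 \<le> M0"
    "\<And>(F :: real \<Rightarrow> 'a) a b A \<delta> g t. \<lbrakk>delta_hyperbolic TYPE('a) \<delta>; \<delta> \<le> A; 0 < A; a \<le> b;
        quasi_geodesic_on l L A {a..b} F; geodesic_path g (F a) (F b); 0 \<le> t; t \<le> dist (F a) (F b)\<rbrakk>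
      \<Longrightarrow> infdist (g t) (F ` {a..b}) \<le> M0 * A"
    using geodesic_near_quasi_geodesic[OF l L] by metis
  define M where "M = L * (2 * M0 + 3) / l + M0 + 2"
  have "gp (F c) (F a) (F b) \<le> M * A"
    if hyp: "delta_hyperbolic TYPE('a) \<delta>" and \<delta>: "\<delta> \<le> A" and A: "0 < A"
      and ac: "a \<le> c" and cb: "c \<le> b" and F: "quasi_geodesic_on l L A {a..b} F"
    for F :: "real \<Rightarrow> 'a" and a b c A \<delta>
  proof -
    obtain g where g: "geodesic_path g (F a) (F b)" using geodesic_pathE[OF geod] .
    define d where "d = dist (F a) (F b)"
    define T where "T S = {t \<in> {0..d}. infdist (g t) (F ` S) \<le> M0 * A}" for S
    have g0: "g 0 = F a" and gd: "g d = F b" using g by (auto simp: geodesic_path_def d_def)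
    have "continuous_on {0..d} g"
      by (rule lipschitz_on_continuous_on[of 1], rule lipschitz_onI)
         (use geodesic_path_dist[OF g] in \<open>auto simp: dist_real_def d_def\<close>)
    then have clo: "closed (T S)" for S
      unfolding T_def by (intro closed_Collect_le continuous_on_infdist continuous_closed_preimage_constant
          continuous_on_closed_Collect_le continuous_intros) auto
    have cover: "{0..d} \<subseteq> T {a..c} \<union> T {c..b}"
    proof
      fix t assume t: "t \<in> {0..d}"
      have "{a..b} = {a..c} \<union> {c..b}" using ac cb by auto
      then have "F ` {a..b} = F ` {a..c} \<union> F ` {c..b}" by auto
      moreover have "infdist (g t) (F ` {a..b}) \<le> M0 * A"
        using t ac cb by (intro M0(2)[OF hyp \<delta> A _ F g]) (auto simp: d_def)
      ultimately have "min (infdist (g t) (F ` {a..c})) (infdist (g t) (F ` {c..b})) \<le> M0 * A"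
        using ac cb by (simp add: infdist_Un_min)
      then show "t \<in> T {a..c} \<union> T {c..b}" using t by (auto simp: T_def min_def split: if_splits)
    qed
    have MA: "0 \<le> M0 * A" using M0 A by simp
    have d0: "0 \<le> d" by (simp add: d_def)
    have "0 \<in> T {a..c}" "d \<in> T {c..b}"
      using d0 MA ac cb by (auto simp: T_def g0 gd)
    then have "T {a..c} \<inter> T {c..b} \<inter> {0..d} \<noteq> {}"
      using connected_closedD[OF connected_Icc[of 0 d], of "T {a..c}" "T {c..b}"] clo cover
      \<open>0 \<in> T {a..c}\<close> \<open>d \<in> T {c..b}\<close> d0 by (auto simp: disjoint_iff)
    then obtain t where t: "t \<in> {0..d}" "infdist (g t) (F ` {a..c}) \<le> M0 * A"
      "infdist (g t) (F ` {c..b}) \<le> M0 * A"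
      by (auto simp: T_def)
    have "\<exists>s\<in>{a..c}. dist (g t) (F s) < (M0 + 1) * A"
      by (rule infdist_lessE[of "F ` {a..c}" "g t" "(M0 + 1) * A"])
         (use ac A t in \<open>auto simp: algebra_simps\<close>)
    then obtain s where s: "s \<in> {a..c}" "dist (g t) (F s) < (M0 + 1) * A" by blast
    have "\<exists>s\<in>{c..b}. dist (g t) (F s) < (M0 + 1) * A"
      by (rule infdist_lessE[of "F ` {c..b}" "g t" "(M0 + 1) * A"])
         (use cb A t in \<open>auto simp: algebra_simps\<close>)
    then obtain s' where s': "s' \<in> {c..b}" "dist (g t) (F s') < (M0 + 1) * A" by blast
    have "dist (F s) (F s') \<le> 2 * (M0 + 1) * A"
      using dist_triangle3[of "F s" "F s'" "g t"] s s' by linarith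
    moreover have "l * \<bar>s - s'\<bar> - A \<le> dist (F s) (F s')"
      by (rule quasi_geodesic_onD[OF F]) (use s s' ac cb in auto)
    ultimately have "l * (s' - s) \<le> (2 * M0 + 3) * A" using s s' by (auto simp: algebra_simps)
    moreover have "l * (c - s) \<le> l * (s' - s)" using s' l by simp
    ultimately have "(c - s) * l \<le> (2 * M0 + 3) * A" by (simp add: mult.commute)
    then have "c - s \<le> (2 * M0 + 3) * A / l" using l by (simp add: pos_le_divide_eq)
    then have 1: "L * (c - s) \<le> L * ((2 * M0 + 3) * A / l)" using L by (rule mult_left_mono)
    have "dist (F c) (F s) \<le> L * \<bar>c - s\<bar> + A"
      by (rule quasi_geodesic_onD[OF F]) (use s ac cb in auto)
    then have "dist (F c) (F s) \<le> L * (2 * M0 + 3) / l * A + A" using s 1 by (simp add: field_simps)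
    then have "dist (F c) (g t) \<le> M * A"
      using dist_triangle[of "F c" "g t" "F s"] s(2) by (simp add: M_def dist_commute algebra_simps)
    moreover have "gp (g t) (F a) (F b) = 0"
      using geodesic_path_gp[OF g, of 0 t d] t g0 gd by (simp add: d_def)
    ultimately show ?thesis using gp_change_base[of "F c" "F a" "F b" "g t"] by simp
  qed
  moreover have "0 \<le> M" using M0 L l by (simp add: M_def)
  ultimately show ?thesis using that by blast
qed

section \<open>Quasi-geodesics whose error grows away from a centre\<close>

text \<open>The additive error is \<open>D\<close> at the parameter 0 and grows at a small linear rate \<open>\<epsilon>\<close> away from it.
  A sublinearly biLipschitz map sends geodesics to such paths, with \<open>D\<close> of the order of \<open>u\<close> at the
  distance from the base-point to the centre.\<close>

definition tapered_quasi_geodesic_on ::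
  "real \<Rightarrow> real \<Rightarrow> real \<Rightarrow> real \<Rightarrow> real set \<Rightarrow> (real \<Rightarrow> 'a::metric_space) \<Rightarrow> bool" where
  "tapered_quasi_geodesic_on l L D \<epsilon> S F \<longleftrightarrow>
     (\<forall>s\<in>S. \<forall>t\<in>S. l * \<bar>s - t\<bar> - (D + \<epsilon> * max \<bar>s\<bar> \<bar>t\<bar>) \<le> dist (F s) (F t) \<and>
                    dist (F s) (F t) \<le> L * \<bar>s - t\<bar> + (D + \<epsilon> * max \<bar>s\<bar> \<bar>t\<bar>))"

lemma tapered_quasi_geodesic_on_subset:
  "tapered_quasi_geodesic_on l L D \<epsilon> S F \<Longrightarrow> S' \<subseteq> S \<Longrightarrow> tapered_quasi_geodesic_on l L D \<epsilon> S' F"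
  unfolding tapered_quasi_geodesic_on_def by blast

lemma tapered_quasi_geodesic_on_from_0:
  assumes "tapered_quasi_geodesic_on l L D \<epsilon> S F" "0 \<in> S" "t \<in> S"
  shows "l * \<bar>t\<bar> - (D + \<epsilon> * \<bar>t\<bar>) \<le> dist (F 0) (F t)"
    "dist (F 0) (F t) \<le> L * \<bar>t\<bar> + (D + \<epsilon> * \<bar>t\<bar>)"
  using bspec[OF bspec[OF assms(1)[unfolded tapered_quasi_geodesic_on_def] assms(2)] assms(3)]
  by (simp_all add: max_def)

lemma tapered_imp_quasi_geodesic:
  assumes F: "tapered_quasi_geodesic_on l L D \<epsilon> S F" and "0 \<le> \<epsilon>"
    and "S' \<subseteq> S" and R: "\<And>s. s \<in> S' \<Longrightarrow> \<bar>s\<bar> \<le> R"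
  shows "quasi_geodesic_on l L (D + \<epsilon> * R) S' F"
  unfolding quasi_geodesic_on_def
proof (intro ballI)
  fix s t assume st: "s \<in> S'" "t \<in> S'"
  have "max \<bar>s\<bar> \<bar>t\<bar> \<le> R" using R st by auto
  then have "\<epsilon> * max \<bar>s\<bar> \<bar>t\<bar> \<le> \<epsilon> * R" using \<open>0 \<le> \<epsilon>\<close> by (rule mult_left_mono)
  moreover have "l * \<bar>s - t\<bar> - (D + \<epsilon> * max \<bar>s\<bar> \<bar>t\<bar>) \<le> dist (F s) (F t)"
    "dist (F s) (F t) \<le> L * \<bar>s - t\<bar> + (D + \<epsilon> * max \<bar>s\<bar> \<bar>t\<bar>)"
    using F st \<open>S' \<subseteq> S\<close> unfolding tapered_quasi_geodesic_on_def by blast+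
  ultimately show "l * \<bar>s - t\<bar> - (D + \<epsilon> * R) \<le> dist (F s) (F t) \<and>
      dist (F s) (F t) \<le> L * \<bar>s - t\<bar> + (D + \<epsilon> * R)" by linarith
qed

lemma tapered_quasi_geodesic_on_uminus:
  assumes "tapered_quasi_geodesic_on l L D \<epsilon> {a..b} F"
  shows "tapered_quasi_geodesic_on l L D \<epsilon> {- b..- a} (\<lambda>s. F (- s))"
  unfolding tapered_quasi_geodesic_on_def
proof (intro ballI)
  fix s t assume "s \<in> {- b..- a}" "t \<in> {- b..- a}"
  then have "- s \<in> {a..b}" "- t \<in> {a..b}" by auto
  from bspec[OF bspec[OF assms[unfolded tapered_quasi_geodesic_on_def] this(1)] this(2)]
  show "l * \<bar>s - t\<bar> - (D + \<epsilon> * max \<bar>s\<bar> \<bar>t\<bar>) \<le> dist (F (- s)) (F (- t)) \<and>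
      dist (F (- s)) (F (- t)) \<le> L * \<bar>s - t\<bar> + (D + \<epsilon> * max \<bar>s\<bar> \<bar>t\<bar>)"
    by (simp add: abs_minus_commute)
qed

text \<open>Seen from \<open>F 0\<close>, the path does not turn back: from \<open>s\<close> on it stays in one direction up to a
  product of order \<open>s\<close>. Between \<open>s\<close> and \<open>2 s\<close> the error is \<open>D + O(\<epsilon> s)\<close>, and ordinary stability at
  this scale shows that \<open>F s\<close> is nearly between \<open>F 0\<close> and \<open>F t\<close>. The dyadic scales are then chained
  together; because the bound doubles at each scale, only one \<open>\<delta>\<close> is lost in total.\<close>

lemma tapered_quasi_geodesic_diverges:
  fixes F :: "real \<Rightarrow> 'a::metric_space"
  assumes hyp: "delta_hyperbolic TYPE('a) \<delta>" and "\<delta> \<le> D" "0 < D" and l: "0 < l" and "0 \<le> M"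
    and M: "\<And>(G :: real \<Rightarrow> 'a) a b c A. \<lbrakk>\<delta> \<le> A; 0 < A; a \<le> c; c \<le> b; quasi_geodesic_on l L A {a..b} G\<rbrakk>
      \<Longrightarrow> gp (G c) (G a) (G b) \<le> M * A"
    and F: "tapered_quasi_geodesic_on l L D \<epsilon> {0..b} F"
    and eps: "0 < \<epsilon>" "(2 * M + 1) * \<epsilon> \<le> l / 4" and \<kappa>: "M + 4 \<le> \<kappa> * l / 4"
    and st: "\<kappa> * D \<le> s" "s \<le> t" "t \<le> b"
  shows "(l / 2) * s - \<delta> \<le> gp (F 0) (F s) (F t)"
proof -
  have "0 \<le> \<delta>" using hyperbolic_constant_nonneg[OF hyp] .
  have "0 < \<kappa> * l" using \<kappa> \<open>0 \<le> M\<close> by linarith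
  then have "0 < \<kappa>" using l by (simp add: zero_less_mult_iff)
  have pos: "0 < s" if "\<kappa> * D \<le> s" for s
    using that mult_pos_pos[OF \<open>0 < \<kappa>\<close> \<open>0 < D\<close>] by linarith
  have direct: "(l / 2) * s \<le> gp (F 0) (F s) (F t)"
    if s: "\<kappa> * D \<le> s" "s \<le> t" "t \<le> b" "t \<le> 2 * s" for s t
  proof -
    have s0: "0 < s" by (rule pos[OF s(1)])
    have "quasi_geodesic_on l L (D + \<epsilon> * (2 * s)) {0..t} F"
      by (rule tapered_imp_quasi_geodesic[OF F]) (use s eps in auto)
    then have "gp (F s) (F 0) (F t) \<le> M * (D + \<epsilon> * (2 * s))"
      by (intro M) (use s s0 eps \<open>\<delta> \<le> D\<close> \<open>0 < D\<close> in \<open>auto intro: add_increasing2 add_pos_pos\<close>)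
    moreover have "l * s - (D + \<epsilon> * s) \<le> dist (F 0) (F s)"
      using tapered_quasi_geodesic_on_from_0(1)[OF F, of s] s s0 by simp
    moreover have "gp (F 0) (F s) (F t) = dist (F 0) (F s) - gp (F s) (F 0) (F t)"
      using gp_add_gp[of "F 0" "F s" "F t"] by simp
    moreover have "(2 * M + 1) * \<epsilon> * s \<le> l / 4 * s" using eps s0 by simp
    moreover have "(M + 4) * D \<le> \<kappa> * l / 4 * D" using \<kappa> \<open>0 < D\<close> by simp
    moreover have "\<kappa> * D * (l / 4) \<le> s * (l / 4)" using s(1) l by (intro mult_right_mono) auto
    ultimately show ?thesis using \<open>0 < D\<close> \<open>0 \<le> M\<close> by (simp add: algebra_simps)
  qed
  have "(l / 2) * s - \<delta> \<le> gp (F 0) (F s) (F t)"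
    if "\<kappa> * D \<le> s" "s \<le> t" "t \<le> b" "t \<le> 2 ^ k * s" for k s t
    using that
  proof (induction k arbitrary: s)
    case 0
    then show ?case using direct[of s t] pos[of s] \<open>0 \<le> \<delta>\<close> by simp
  next
    case (Suc k)
    show ?case
    proof (cases "t \<le> 2 * s")
      case True
      then show ?thesis using direct[of s t] Suc \<open>0 \<le> \<delta>\<close> by simp
    next
      case False
      have "0 < s" by (rule pos[OF Suc.prems(1)])
      have 1: "(l / 2) * s \<le> gp (F 0) (F s) (F (2 * s))"
        using direct[of s "2 * s"] Suc False \<open>0 < s\<close> by simp
      have 2: "(l / 2) * (2 * s) - \<delta> \<le> gp (F 0) (F (2 * s)) (F t)"
        by (rule Suc.IH) (use Suc.prems False \<open>0 < s\<close> in auto)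
      have "M + 4 \<le> \<kappa> * l / 2" using \<kappa> \<open>0 < \<kappa> * l\<close> by linarith
      then have "1 * D \<le> \<kappa> * l / 2 * D"
        using \<open>0 \<le> M\<close> \<open>0 < D\<close> by (intro mult_right_mono) auto
      moreover have "\<kappa> * D * (l / 2) \<le> s * (l / 2)"
        using Suc.prems(1) l by (intro mult_right_mono) auto
      moreover have "\<kappa> * D * (l / 2) = \<kappa> * l / 2 * D" "s * (l / 2) = (l / 2) * s" by simp_all
      ultimately have "\<delta> \<le> (l / 2) * s" using \<open>\<delta> \<le> D\<close> by linarith
      then show ?thesis
        using 1 2 hyperbolicD[OF hyp, of "F 0" "F s" "F (2 * s)" "F t"] by (simp add: min_def split: if_splits)
    qed
  qed
  moreover obtain k where "t / s < 2 ^ k" using real_arch_pow[of 2 "t / s"] by auto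
  moreover have "0 < s" by (rule pos[OF st(1)])
  ultimately show ?thesis using st by (meson divide_less_eq less_imp_le)
qed

text \<open>Stability at the centre, with no dependence on the length of the path. In the window of
  radius \<open>s0 = \<kappa> D\<close> the error is \<open>O(D)\<close>, so \<open>F (- s0)\<close> and \<open>F s0\<close> have a product \<open>O(D)\<close> at \<open>F 0\<close>.
  Beyond the window each end of the path leaves in the direction of the corresponding end of the
  window, with a larger product when \<open>\<kappa>\<close> is large. By hyperbolicity the ends of the path cannot then
  have a larger product than the ends of the window.\<close>

lemma tapered_quasi_geodesic_stability:
  fixes l L :: real
  assumes l: "0 < l" and L: "0 \<le> L" and geod: "geodesic_space TYPE('a::metric_space)"
  obtains M \<epsilon> where "0 \<le> M" "0 < \<epsilon>"
    "\<And>(F :: real \<Rightarrow> 'a) a b D \<delta>. \<lbrakk>delta_hyperbolic TYPE('a) \<delta>; \<delta> \<le> D; 0 < D;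
        a \<le> 0; 0 \<le> b; tapered_quasi_geodesic_on l L D \<epsilon> {a..b} F\<rbrakk>
      \<Longrightarrow> gp (F 0) (F a) (F b) \<le> M * D"
proof -
  obtain M where M0: "0 \<le> M" and
    M: "\<And>(F :: real \<Rightarrow> 'a) a b c A \<delta>. \<lbrakk>delta_hyperbolic TYPE('a) \<delta>; \<delta> \<le> A; 0 < A;
        a \<le> c; c \<le> b; quasi_geodesic_on l L A {a..b} F\<rbrakk>
      \<Longrightarrow> gp (F c) (F a) (F b) \<le> M * A"
    using quasi_geodesic_stability[OF l L geod] by metis
  \<comment> \<open>The rate \<open>\<epsilon>\<close> makes the stability error at scale \<open>s\<close> a small fraction of \<open>l s\<close>, and \<open>\<kappa>\<close> makes
    the fixed part \<open>M D\<close> of the error small compared with \<open>l \<kappa> D\<close>.\<close>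
  define \<epsilon> where "\<epsilon> = l / (8 * (M + 1))"
  define \<kappa> where "\<kappa> = 4 * (M + 4) / l"
  define M' where "M' = (M + L + 1) * (1 + (\<epsilon> + 1) * \<kappa>) + 2"
  have eps: "0 < \<epsilon>" "(2 * M + 1) * \<epsilon> \<le> l / 4" "M * \<epsilon> \<le> l / 8"
    using l M0 by (simp_all add: \<epsilon>_def field_simps)
  have \<kappa>: "0 < \<kappa>" "\<kappa> * l / 4 = M + 4" using l M0 by (auto simp: \<kappa>_def)
  have "gp (F 0) (F a) (F b) \<le> M' * D"
    if hyp: "delta_hyperbolic TYPE('a) \<delta>" and D: "\<delta> \<le> D" "0 < D"
      and ab: "a \<le> 0" "0 \<le> b" and F: "tapered_quasi_geodesic_on l L D \<epsilon> {a..b} F"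
    for F :: "real \<Rightarrow> 'a" and a b D \<delta>
  proof -
    have "0 \<le> \<delta>" using hyperbolic_constant_nonneg[OF hyp] .
    define s0 where "s0 = \<kappa> * D"
    have s0: "0 < s0" using \<kappa> D by (simp add: s0_def)
    have M'D: "(M + L + 1) * (D + (\<epsilon> + 1) * s0) + 2 * D = M' * D"
      by (simp add: M'_def s0_def algebra_simps)
    have near: "dist (F 0) (F t) \<le> M' * D" if t: "t \<in> {a..b}" "\<bar>t\<bar> \<le> s0" for t
    proof -
      have "dist (F 0) (F t) \<le> L * \<bar>t\<bar> + (D + \<epsilon> * \<bar>t\<bar>)"
        using tapered_quasi_geodesic_on_from_0(2)[OF F, of t] t ab by simp
      also have "\<dots> \<le> L * s0 + (D + \<epsilon> * s0)"
        using L eps t by (intro add_mono mult_left_mono) auto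
      also have "\<dots> \<le> (M + L + 1) * (D + (\<epsilon> + 1) * s0) + 2 * D"
        using s0 D L M0 eps by (simp add: algebra_simps)
      finally show ?thesis by (simp add: M'D)
    qed
    show ?thesis
    proof (cases "b \<le> s0 \<or> - a \<le> s0")
      case True
      then show ?thesis
      proof
        assume "b \<le> s0"
        then show ?thesis using near[of b] ab gp_le_dist(2)[of "F 0" "F a" "F b"] by simp
      next
        assume "- a \<le> s0"
        then show ?thesis using near[of a] ab gp_le_dist(1)[of "F 0" "F a" "F b"] by simp
      qed
    next
      case False
      have "quasi_geodesic_on l L (D + \<epsilon> * s0) {- s0..s0} F"
        by (rule tapered_imp_quasi_geodesic[OF F]) (use False eps s0 in auto)
      then have mid: "gp (F 0) (F (- s0)) (F s0) \<le> M * (D + \<epsilon> * s0)"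
        by (intro M[OF hyp]) (use D s0 eps in \<open>auto intro: add_increasing2 add_pos_pos\<close>)
      have Fp: "tapered_quasi_geodesic_on l L D \<epsilon> {0..b} F"
        by (rule tapered_quasi_geodesic_on_subset[OF F]) (use ab in auto)
      have Fm: "tapered_quasi_geodesic_on l L D \<epsilon> {0..- a} (\<lambda>s. F (- s))"
        by (rule tapered_quasi_geodesic_on_subset[OF tapered_quasi_geodesic_on_uminus[OF F]]) (use ab in auto)
      have p: "(l / 2) * s0 - \<delta> \<le> gp (F 0) (F s0) (F b)"
        by (rule tapered_quasi_geodesic_diverges[OF hyp D l M0 M[OF hyp] Fp eps(1,2)])
           (use \<kappa> False in \<open>auto simp: s0_def\<close>)
      have "(l / 2) * s0 - \<delta> \<le> gp (F (- 0)) (F (- s0)) (F (- (- a)))"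
        by (rule tapered_quasi_geodesic_diverges[OF hyp D l M0 M[OF hyp] Fm eps(1,2)])
           (use \<kappa> False in \<open>auto simp: s0_def\<close>)
      then have m: "(l / 2) * s0 - \<delta> \<le> gp (F 0) (F (- s0)) (F a)" by simp
      have "M * \<epsilon> * s0 \<le> l / 8 * s0" using eps(3) s0 by (intro mult_right_mono) auto
      moreover have "l * s0 = 4 * (M * D) + 16 * D" using \<kappa>(2) by (simp add: s0_def field_simps)
      moreover have "M * (D + \<epsilon> * s0) = M * D + M * \<epsilon> * s0" by (simp add: algebra_simps)
      moreover have "0 \<le> M * D" using M0 D by simp
      ultimately have "M * (D + \<epsilon> * s0) + 2 * \<delta> < (l / 2) * s0 - \<delta>" using D by linarith
      then have "gp (F 0) (F a) (F b) \<le> M * (D + \<epsilon> * s0) + 2 * \<delta>"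
        using hyperbolicD2[OF hyp, of "F 0" "F (- s0)" "F a" "F b" "F s0"] mid p m
        by (auto simp: min_def gp_commute split: if_splits)
      also have "\<dots> \<le> (M + L + 1) * (D + (\<epsilon> + 1) * s0) + 2 * D"
        using D eps s0 M0 L \<open>0 \<le> \<delta>\<close> by (intro add_mono mult_mono) auto
      finally show ?thesis by (simp add: M'D)
    qed
  qed
  moreover have "0 \<le> M'" unfolding M'_def using M0 L eps \<kappa> by (intro add_nonneg_nonneg mult_nonneg_nonneg) auto
  ultimately show ?thesis using that eps(1) by blast
qed

section \<open>Admissible functions\<close>

lemma admissible_ge_1: "admissible u \<Longrightarrow> 0 \<le> r \<Longrightarrow> 1 \<le> u r"
  by (auto simp: admissible_def)

lemma admissible_mono: "admissible u \<Longrightarrow> 0 \<le> r \<Longrightarrow> r \<le> s \<Longrightarrow> u r \<le> u s"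
  by (auto simp: admissible_def mono_on_def)

lemma admissible_doubling:
  assumes u: "admissible u"
  obtains K where "1 \<le> K" "\<And>r. 0 \<le> r \<Longrightarrow> u (2 * r) \<le> K * u r"
proof -
  have "Limsup at_top (\<lambda>r. ereal (u (2 * r) / u r)) < \<infinity>" using u by (simp add: admissible_def)
  then obtain c where c: "Limsup at_top (\<lambda>r. ereal (u (2 * r) / u r)) < ereal c"
    using less_PInf_Ex_of_nat by (metis ereal_dense2)
  have "eventually (\<lambda>r. ereal (u (2 * r) / u r) < ereal c) at_top"
    using Limsup_lessD[OF c] .
  then obtain r0 where r0: "\<And>r. r0 \<le> r \<Longrightarrow> u (2 * r) / u r < c"
    by (auto simp: eventually_at_top_linorder)
  define K where "K = max (max 1 c) (u (2 * max 0 r0))"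
  have "u (2 * r) \<le> K * u r" if r: "0 \<le> r" for r
  proof (cases "r0 \<le> r")
    case True
    have "u (2 * r) \<le> c * u r"
      using r0[OF True] admissible_ge_1[OF u r] by (simp add: field_simps)
    also have "\<dots> \<le> K * u r"
      using admissible_ge_1[OF u r] by (intro mult_right_mono) (auto simp: K_def)
    finally show ?thesis .
  next
    case False
    have "u (2 * r) \<le> u (2 * max 0 r0)" using False r by (intro admissible_mono[OF u]) auto
    also have "\<dots> \<le> K * 1" by (simp add: K_def)
    also have "\<dots> \<le> K * u r"
      using admissible_ge_1[OF u r] by (intro mult_left_mono) (auto simp: K_def)
    finally show ?thesis .
  qed
  then show ?thesis using that[of K] by (simp add: K_def)
qed

text \<open>Doubling and sublinearity combined: for \<open>t \<le> r\<close> the doubling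
  property controls \<open>u (r + t)\<close> by \<open>u r\<close>, and for larger \<open>t\<close> sublinearity controls it by \<open>t\<close>, except on
  a bounded range where \<open>u \<ge> 1\<close> suffices.\<close>

lemma admissible_absorb:
  assumes u: "admissible u" and \<epsilon>: "0 < \<epsilon>"
  obtains C where "1 \<le> C" "\<And>r t. \<lbrakk>0 \<le> r; 0 \<le> t\<rbrakk> \<Longrightarrow> u (r + t) \<le> C * u r + \<epsilon> * t"
proof -
  have "((\<lambda>r. u r / r) \<longlongrightarrow> 0) at_top" using u by (simp add: admissible_def)
  then have "eventually (\<lambda>r. u r / r < \<epsilon> / 2) at_top" using \<epsilon> by (intro order_tendstoD) auto
  then obtain r0 where r0: "\<And>r. r0 \<le> r \<Longrightarrow> u r / r < \<epsilon> / 2" by (auto simp: eventually_at_top_linorder)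
  obtain K where K: "1 \<le> K" "\<And>r. 0 \<le> r \<Longrightarrow> u (2 * r) \<le> K * u r"
    using admissible_doubling[OF u] by blast
  define T where "T = max 1 r0"
  define C where "C = max K (u T)"
  have "u (r + t) \<le> C * u r + \<epsilon> * t" if r: "0 \<le> r" and t: "0 \<le> t" for r t
  proof -
    have ur: "1 \<le> u r" using admissible_ge_1[OF u r] .
    have C1: "1 \<le> C" using K by (simp add: C_def)
    have et: "0 \<le> \<epsilon> * t" using \<epsilon> t by simp
    have Cu: "0 \<le> C * u r" using C1 ur by simp
    consider "t \<le> r" | "r < t" "r + t \<le> T" | "r < t" "T < r + t" by linarith
    then show ?thesis
    proof cases
      case 1
      have "u (r + t) \<le> u (2 * r)" using 1 r t by (intro admissible_mono[OF u]) auto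
      also have "\<dots> \<le> K * u r" using K r by simp
      also have "\<dots> \<le> C * u r" using ur by (intro mult_right_mono) (auto simp: C_def)
      finally show ?thesis using et by linarith
    next
      case 2
      have "u (r + t) \<le> u T" using 2 r t by (intro admissible_mono[OF u]) auto
      also have "\<dots> \<le> C * 1" by (simp add: C_def)
      also have "\<dots> \<le> C * u r" using ur C1 by (intro mult_left_mono) auto
      finally show ?thesis using et by linarith
    next
      case 3
      have "u (r + t) < \<epsilon> / 2 * (r + t)"
        using r0[of "r + t"] 3 r by (simp add: T_def field_simps)
      also have "\<dots> \<le> \<epsilon> / 2 * (2 * t)" using 3 \<epsilon> by (intro mult_left_mono) auto
      finally show ?thesis using Cu by simp
    qed
  qed
  then show ?thesis using that[of C] K by (simp add: C_def)
qed

lemma admissible_shift: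
  assumes u: "admissible u" and c: "0 \<le> c"
  obtains B where "1 \<le> B" "\<And>r. 0 \<le> r \<Longrightarrow> u (r + c) \<le> B * u r"
proof -
  obtain C where C: "1 \<le> C" "\<And>r t. \<lbrakk>0 \<le> r; 0 \<le> t\<rbrakk> \<Longrightarrow> u (r + t) \<le> C * u r + 1 * t"
    using admissible_absorb[OF u, of 1] by auto
  have "u (r + c) \<le> (C + c) * u r" if "0 \<le> r" for r
  proof -
    have "u (r + c) \<le> C * u r + c" using C(2)[OF that c] by simp
    also have "\<dots> \<le> C * u r + c * u r"
      using admissible_ge_1[OF u that] c by (simp add: mult_le_cancel_left1)
    finally show ?thesis by (simp add: algebra_simps)
  qed
  then show ?thesis using that[of "C + c"] C c by simp
qed

lemma admissible_dominated_by_linear: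
  assumes u: "admissible u" and l: "0 < l" and K: "0 \<le> K"
  shows "\<exists>R. \<forall>r\<ge>R. c \<le> l * r - K * u r"
proof -
  define \<epsilon> where "\<epsilon> = l / (2 * (K + 1))"
  have \<epsilon>: "0 < \<epsilon>" "K * \<epsilon> \<le> l / 2" using l K by (auto simp: \<epsilon>_def field_simps)
  obtain C where C: "1 \<le> C" "\<And>r t. \<lbrakk>0 \<le> r; 0 \<le> t\<rbrakk> \<Longrightarrow> u (r + t) \<le> C * u r + \<epsilon> * t"
    using admissible_absorb[OF u \<epsilon>(1)] by blast
  have "c \<le> l * r - K * u r" if r: "max 0 ((c + K * C * u 0) / (l / 2)) \<le> r" for r
  proof -
    have "K * u r \<le> K * (C * u 0 + \<epsilon> * r)"
      using C(2)[of 0 r] r K by (intro mult_left_mono) auto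
    moreover have "K * \<epsilon> * r \<le> l / 2 * r" using \<epsilon> r by (intro mult_right_mono) auto
    moreover have "c + K * C * u 0 \<le> l / 2 * r" using r l by (simp add: field_simps)
    ultimately show ?thesis by (simp add: algebra_simps)
  qed
  then show ?thesis by blast
qed

section \<open>Images of geodesics under sublinearly biLipschitz maps\<close>

text \<open>The metric part of the definition of a sublinearly biLipschitz equivalence, in a ball of
  radius \<open>r\<close> around \<open>p\<close>.\<close>

definition sublinear_biLipschitz_bounds ::
  "'a::metric_space \<Rightarrow> real \<Rightarrow> real \<Rightarrow> (real \<Rightarrow> real) \<Rightarrow> ('a \<Rightarrow> 'b::metric_space) \<Rightarrow> bool" where
  "sublinear_biLipschitz_bounds p l L w f \<longleftrightarrow>
     (\<forall>x x' r. dist p x \<le> r \<longrightarrow> dist p x' \<le> r \<longrightarrow>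
        l * dist x x' - w r \<le> dist (f x) (f x') \<and> dist (f x) (f x') \<le> L * dist x x' + w r)"

lemma sublinear_biLipschitz_boundsD:
  assumes "sublinear_biLipschitz_bounds p l L w f" "dist p x \<le> r" "dist p x' \<le> r"
  shows "l * dist x x' - w r \<le> dist (f x) (f x')" "dist (f x) (f x') \<le> L * dist x x' + w r"
  using assms by (auto simp: sublinear_biLipschitz_bounds_def)

text \<open>The asymptotic bound \<open>w = O(u)\<close> becomes a bound on all of \<open>{0..}\<close> because \<open>w\<close> is
  nondecreasing and \<open>u \<ge> 1\<close>.\<close>

lemma SBE_imp_bounds:
  assumes u: "admissible u" and f: "SBE p q l L u f"
  obtains C where "0 \<le> C" "sublinear_biLipschitz_bounds p l L (\<lambda>r. C * u r) f"
proof -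
  obtain w where w: "mono_on {0..} w" "w \<in> O[at_top](u)" and
    fw: "\<And>x x'. l * dist x x' - w (max (dist p x) (dist p x')) \<le> dist (f x) (f x')"
    "\<And>x x'. dist (f x) (f x') \<le> L * dist x x' + w (max (dist p x) (dist p x'))"
    using f unfolding SBE_def by blast
  obtain c where c: "0 < c" "eventually (\<lambda>r. norm (w r) \<le> c * norm (u r)) at_top"
    using w(2) by (auto elim!: landau_o.bigE)
  then obtain r0 where r0: "\<And>r. r0 \<le> r \<Longrightarrow> norm (w r) \<le> c * norm (u r)"
    by (auto simp: eventually_at_top_linorder)
  define C where "C = max c (w (max 0 r0))"
  have wC: "w r \<le> C * u r" if r: "0 \<le> r" for r
  proof (cases "r0 \<le> r")
    case True
    have "w r \<le> c * u r" using r0[OF True] admissible_ge_1[OF u r] by simp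
    also have "\<dots> \<le> C * u r"
      using admissible_ge_1[OF u r] by (intro mult_right_mono) (auto simp: C_def)
    finally show ?thesis .
  next
    case False
    have "w r \<le> w (max 0 r0)" using w(1) False r by (auto simp: mono_on_def)
    also have "\<dots> \<le> C * 1" by (simp add: C_def)
    also have "\<dots> \<le> C * u r"
      using admissible_ge_1[OF u r] c by (intro mult_left_mono) (auto simp: C_def)
    finally show ?thesis .
  qed
  have "sublinear_biLipschitz_bounds p l L (\<lambda>r. C * u r) f"
    unfolding sublinear_biLipschitz_bounds_def
  proof (intro allI impI)
    fix x x' r assume r: "dist p x \<le> r" "dist p x' \<le> r"
    have m: "0 \<le> max (dist p x) (dist p x')" "max (dist p x) (dist p x') \<le> r"
      using r by (auto simp: le_max_iff_disj)
    have "w (max (dist p x) (dist p x')) \<le> w r" using w(1) m by (auto simp: mono_on_def)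
    also have "\<dots> \<le> C * u r" using m by (intro wC) linarith
    finally show "l * dist x x' - C * u r \<le> dist (f x) (f x') \<and>
        dist (f x) (f x') \<le> L * dist x x' + C * u r"
      using fw[of x x'] by linarith
  qed
  moreover have "0 \<le> C" using c by (simp add: C_def)
  ultimately show ?thesis using that by blast
qed

text \<open>If \<open>m\<close> is nearly between \<open>x\<close> and \<open>y\<close>, then \<open>f m\<close> is between \<open>f x\<close> and \<open>f y\<close> up to an error of
  order \<open>u\<close> at the distance from \<open>p\<close> to \<open>m\<close>, however far away \<open>x\<close> and \<open>y\<close> are. Along the geodesic
  through \<open>m\<close> at arc length \<open>t\<close> the map has error \<open>O(u (|m| + t))\<close>, which \<open>admissible_absorb\<close>
  replaces by \<open>O(u |m|) + \<epsilon> t\<close>; this is a tapered quasi-geodesic centred at \<open>f m\<close>.\<close>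

lemma sublinear_stability:
  fixes p :: "'a::metric_space" and f :: "'a \<Rightarrow> 'b::metric_space"
  assumes u: "admissible u" and l: "0 < l" and L: "0 < L"
    and geoa: "geodesic_space TYPE('a)" and geob: "geodesic_space TYPE('b)"
    and hypa: "delta_hyperbolic TYPE('a) \<delta>" and hypb: "delta_hyperbolic TYPE('b) \<delta>"
    and C: "0 \<le> C" and f: "sublinear_biLipschitz_bounds p l L (\<lambda>r. C * u r) f" and c: "0 \<le> c"
  obtains K where "0 \<le> K"
    "\<And>m x y. gp m x y \<le> c \<Longrightarrow> gp (f m) (f x) (f y) \<le> K * u (dist p m)"
proof -
  have "0 \<le> \<delta>" using hyperbolic_constant_nonneg[OF hypa] .
  obtain M \<epsilon> where M: "0 \<le> M" "0 < \<epsilon>"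
    "\<And>(F :: real \<Rightarrow> 'b) a b D \<delta>. \<lbrakk>delta_hyperbolic TYPE('b) \<delta>; \<delta> \<le> D; 0 < D;
        a \<le> 0; 0 \<le> b; tapered_quasi_geodesic_on l L D \<epsilon> {a..b} F\<rbrakk>
      \<Longrightarrow> gp (F 0) (F a) (F b) \<le> M * D"
    using tapered_quasi_geodesic_stability[OF l less_imp_le[OF L] geob] by metis
  have \<epsilon>C: "0 < \<epsilon> / (C + 1)" using M C by simp
  obtain C1 where C1: "1 \<le> C1"
    "\<And>r t. \<lbrakk>0 \<le> r; 0 \<le> t\<rbrakk> \<Longrightarrow> u (r + t) \<le> C1 * u r + \<epsilon> / (C + 1) * t"
    using admissible_absorb[OF u \<epsilon>C] by blast
  define c' where "c' = c + 2 * \<delta>"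
  have c': "0 \<le> c'" using c \<open>0 \<le> \<delta>\<close> by (simp add: c'_def)
  obtain B where B: "1 \<le> B" "\<And>r. 0 \<le> r \<Longrightarrow> u (r + c') \<le> B * u r"
    using admissible_shift[OF u c'] by blast
  define N where "N = C * C1 + \<delta> + 1"
  have N: "0 < N" "\<delta> \<le> N" using C C1 \<open>0 \<le> \<delta>\<close> by (auto simp: N_def add_nonneg_pos)
  have on_geodesic: "gp (f (g t0)) (f x) (f y) \<le> M * (N * u (dist p (g t0)))"
    if g: "geodesic_path g x y" and t0: "0 \<le> t0" "t0 \<le> dist x y" for g x y t0
  proof -
    define r where "r = dist p (g t0)"
    define F where "F s = f (g (t0 + s))" for s
    have r: "0 \<le> r" by (simp add: r_def)
    have ur: "1 \<le> u r" using admissible_ge_1[OF u r] .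
    have taper: "tapered_quasi_geodesic_on l L (N * u r) \<epsilon> {- t0..dist x y - t0} F"
      unfolding tapered_quasi_geodesic_on_def
    proof (intro ballI)
      fix s t assume st: "s \<in> {- t0..dist x y - t0}" "t \<in> {- t0..dist x y - t0}"
      define \<tau> where "\<tau> = max \<bar>s\<bar> \<bar>t\<bar>"
      have \<tau>: "\<bar>s\<bar> \<le> \<tau>" "\<bar>t\<bar> \<le> \<tau>" by (auto simp: \<tau>_def)
      have far: "dist p (g (t0 + s')) \<le> r + \<tau>"
        if "s' \<in> {- t0..dist x y - t0}" "\<bar>s'\<bar> \<le> \<tau>" for s'
        using dist_triangle[of p "g (t0 + s')" "g t0"] geodesic_path_dist[OF g, of t0 "t0 + s'"] that t0
        by (simp add: r_def)
      have d: "dist (g (t0 + s)) (g (t0 + t)) = \<bar>s - t\<bar>"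
        using geodesic_path_dist[OF g, of "t0 + s" "t0 + t"] st by simp
      have \<tau>0: "0 \<le> \<tau>" using \<tau> by linarith
      have "C * u (r + \<tau>) \<le> C * (C1 * u r + \<epsilon> / (C + 1) * \<tau>)"
        using C1(2)[OF r \<tau>0] C by (rule mult_left_mono)
      also have "\<dots> = C * C1 * u r + C / (C + 1) * (\<epsilon> * \<tau>)" by (simp add: algebra_simps)
      also have "\<dots> \<le> N * u r + 1 * (\<epsilon> * \<tau>)"
        using C M(2) \<tau>0 ur \<open>0 \<le> \<delta>\<close> by (intro add_mono mult_right_mono) (auto simp: N_def)
      finally have "C * u (r + \<tau>) \<le> N * u r + \<epsilon> * \<tau>" by simp
      with sublinear_biLipschitz_boundsD[OF f far[OF st(1) \<tau>(1)] far[OF st(2) \<tau>(2)]]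
      show "l * \<bar>s - t\<bar> - (N * u r + \<epsilon> * max \<bar>s\<bar> \<bar>t\<bar>) \<le> dist (F s) (F t) \<and>
          dist (F s) (F t) \<le> L * \<bar>s - t\<bar> + (N * u r + \<epsilon> * max \<bar>s\<bar> \<bar>t\<bar>)"
        by (simp add: F_def d \<tau>_def)
    qed
    have "N * 1 \<le> N * u r" using N ur by (intro mult_left_mono) auto
    then have "0 < N * u r" "\<delta> \<le> N * u r" using N by linarith+
    then have "gp (F 0) (F (- t0)) (F (dist x y - t0)) \<le> M * (N * u r)"
      using t0 by (intro M(3)[OF hypb _ _ _ _ taper]) auto
    moreover have "g 0 = x" "g (dist x y) = y" using g by (auto simp: geodesic_path_def)
    ultimately show ?thesis by (simp add: F_def r_def)
  qed
  define K where "K = M * N * B + L * c' + C * B"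
  have "gp (f m) (f x) (f y) \<le> K * u (dist p m)" if m: "gp m x y \<le> c" for m x y
  proof -
    obtain g where g: "geodesic_path g x y" using geodesic_pathE[OF geoa] .
    define t0 where "t0 = gp x y m"
    \<comment> \<open>The projection of \<open>m\<close> to the geodesic, which is at bounded distance from \<open>m\<close>.\<close>
    define m' where "m' = g t0"
    have t0: "0 \<le> t0" "t0 \<le> dist x y" by (auto simp: t0_def gp_nonneg gp_le_dist)
    have tri: "gp m' x y = 0" "gp m' x m \<le> \<delta>" "gp m' y m \<le> \<delta>"
      using tripod_centre[OF hypa g, of m' m] by (auto simp: m'_def t0_def)
    have mm': "dist m m' \<le> c'"
      using gp_through[of m x y m'] tri m by (simp add: c'_def gp_commute)
    define r where "r = dist p m"
    have r: "0 \<le> r" by (simp add: r_def)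
    have ur: "1 \<le> u r" using admissible_ge_1[OF u r] .
    have dm': "dist p m' \<le> r + c'" using dist_triangle[of p m' m] mm' by (simp add: r_def)
    have "u (dist p m') \<le> u (r + c')" by (rule admissible_mono[OF u _ dm']) simp
    then have um': "u (dist p m') \<le> B * u r" and ur': "u (r + c') \<le> B * u r"
      using B(2)[OF r] by auto
    have "gp (f m') (f x) (f y) \<le> M * (N * u (dist p m'))"
      unfolding m'_def by (rule on_geodesic[OF g t0])
    also have "\<dots> \<le> M * (N * (B * u r))" using M N um' by (intro mult_left_mono) auto
    finally have 1: "gp (f m') (f x) (f y) \<le> M * N * B * u r" by (simp add: mult.assoc)
    have "dist (f m) (f m') \<le> L * dist m m' + C * u (r + c')"
      using c' by (intro sublinear_biLipschitz_boundsD[OF f _ dm']) (simp add: r_def)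
    also have "\<dots> \<le> L * (c' * u r) + C * (B * u r)"
    proof -
      have "dist m m' \<le> c' * u r" using mm' mult_left_mono[OF ur c'] by simp
      then show ?thesis using L C ur' by (intro add_mono mult_left_mono) auto
    qed
    finally have "dist (f m) (f m') \<le> (L * c' + C * B) * u r" by (simp add: algebra_simps)
    with 1 gp_change_base[of "f m" "f x" "f y" "f m'"]
    show ?thesis by (simp add: K_def r_def algebra_simps)
  qed
  moreover have "0 \<le> K" unfolding K_def using M N B L C c' by (intro add_nonneg_nonneg mult_nonneg_nonneg) auto
  ultimately show ?thesis using that by blast
qed

text \<open>Here \<open>r\<close> is the distance from \<open>p\<close> to the centre \<open>m\<close> of the triangle \<open>p, x, y\<close>. By
  \<open>sublinear_stability\<close> its image is an approximate centre of the image triangle, so the product of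
  the images is the distance from \<open>f p\<close> to \<open>f m\<close> up to \<open>O(u r)\<close>.\<close>

lemma product_distortion:
  fixes p :: "'a::metric_space" and f :: "'a \<Rightarrow> 'b::metric_space"
  assumes u: "admissible u" and l: "0 < l" and L: "0 < L"
    and geoa: "geodesic_space TYPE('a)" and geob: "geodesic_space TYPE('b)"
    and hypa: "delta_hyperbolic TYPE('a) \<delta>" and hypb: "delta_hyperbolic TYPE('b) \<delta>"
    and C: "0 \<le> C" and f: "sublinear_biLipschitz_bounds p l L (\<lambda>r. C * u r) f"
  obtains K where "0 \<le> K"
    "\<And>x y. \<exists>r. gp p x y \<le> r \<and> r \<le> gp p x y + 2 * \<delta> \<and>
        l * r - K * u r \<le> gp (f p) (f x) (f y) \<and> gp (f p) (f x) (f y) \<le> L * r + K * u r"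
proof -
  have "0 \<le> \<delta>" using hyperbolic_constant_nonneg[OF hypa] .
  then obtain K where K: "0 \<le> K"
    "\<And>m x y. gp m x y \<le> \<delta> \<Longrightarrow> gp (f m) (f x) (f y) \<le> K * u (dist p m)"
    using sublinear_stability[OF u l L geoa geob hypa hypb C f] by metis
  have "\<exists>r. gp p x y \<le> r \<and> r \<le> gp p x y + 2 * \<delta> \<and>
        l * r - (C + 2 * K) * u r \<le> gp (f p) (f x) (f y) \<and> gp (f p) (f x) (f y) \<le> L * r + (C + 2 * K) * u r"
    for x y
  proof -
    obtain g where g: "geodesic_path g x y" using geodesic_pathE[OF geoa] .
    define m where "m = g (gp x y p)"
    note tri = tripod_centre[OF hypa g m_def]
    define r where "r = dist p m"
    have r: "0 \<le> r" by (simp add: r_def)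
    have ur: "1 \<le> u r" using admissible_ge_1[OF u r] .
    have 1: "gp p x y \<le> r" using gp_change_base[of p x y m] tri by (simp add: r_def)
    have 2: "r \<le> gp p x y + 2 * \<delta>" using gp_through[of p x y m] tri by (simp add: r_def gp_commute)
    have d: "l * r - C * u r \<le> dist (f p) (f m)" "dist (f p) (f m) \<le> L * r + C * u r"
      using sublinear_biLipschitz_boundsD[OF f, of p r m] by (simp_all add: r_def)
    have "gp (f m) (f x) (f y) \<le> K * u r" "gp (f m) (f p) (f x) \<le> K * u r"
      "gp (f m) (f p) (f y) \<le> K * u r"
      unfolding r_def using tri \<open>0 \<le> \<delta>\<close> by (auto intro!: K simp: gp_commute)
    then have "l * r - (C + 2 * K) * u r \<le> gp (f p) (f x) (f y)"
      "gp (f p) (f x) (f y) \<le> L * r + (C + 2 * K) * u r"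
      using gp_through[of "f p" "f x" "f y" "f m"] d gp_nonneg[of "f m" "f x" "f y"]
        gp_nonneg[of "f m" "f p" "f x"] gp_nonneg[of "f m" "f p" "f y"]
      by (simp_all add: algebra_simps)
    then show ?thesis using 1 2 by blast
  qed
  then show ?thesis using that[of "C + 2 * K"] C K by simp
qed

section \<open>Cross-differences of four points\<close>

text \<open>The analogue for points of the space of the logarithm of the cross-ratio. It is defined by
  distances alone, so that it is given by the same combination of Gromov products at every
  base-point.\<close>

definition cross_difference :: "'a::metric_space \<Rightarrow> 'a \<Rightarrow> 'a \<Rightarrow> 'a \<Rightarrow> real" where
  "cross_difference x1 x2 x3 x4 = (dist x1 x3 + dist x2 x4 - dist x1 x4 - dist x2 x3) / 2"

lemma cross_difference_gp:
  "cross_difference x1 x2 x3 x4 = gp z x1 x4 + gp z x2 x3 - gp z x1 x3 - gp z x2 x4"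
  by (simp add: cross_difference_def gromov_product_def field_simps)

lemma cross_difference_le: "cross_difference x1 x2 x3 x4 \<le> gp z x1 x4 + gp z x2 x3"
  using gp_nonneg[of z x1 x3] gp_nonneg[of z x2 x4] by (simp add: cross_difference_gp[of _ _ _ _ z])

text \<open>The sum that pairs \<open>x\<close> with \<open>y\<close> is the smallest of the three sums of opposite distances. In a
  tree this means that the path from \<open>x\<close> to \<open>y\<close> and the path from \<open>z\<close> to \<open>w\<close> have at most one point
  in common, so \<open>z\<close> and \<open>w\<close> leave the path from \<open>x\<close> to \<open>y\<close> at the same point \<open>a\<close>, the branch point
  of \<open>x, y, z\<close>. The distance from \<open>p\<close> to \<open>a\<close> is governed by the largest product of \<open>x, y, z\<close>,
  because \<open>p\<close> shares its direction from \<open>a\<close> with at most one of the three.\<close>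

lemma four_point_centre:
  assumes hyp: "delta_hyperbolic TYPE('a::metric_space) \<delta>" and geod: "geodesic_space TYPE('a)"
    and min: "dist x y + dist z w \<le> dist x z + dist y w"
      "dist x y + dist z w \<le> dist x w + dist y (z::'a)"
  obtains a where "gp a x y = 0" "gp a x z \<le> 2 * \<delta>" "gp a y z \<le> 2 * \<delta>"
    "gp a x w \<le> 2 * \<delta>" "gp a y w \<le> 2 * \<delta>"
    "\<And>p R. \<lbrakk>gp p x y \<le> R; gp p x z \<le> R; gp p y z \<le> R\<rbrakk> \<Longrightarrow> dist p a \<le> R + 4 * \<delta>"
proof -
  have "0 \<le> \<delta>" using hyperbolic_constant_nonneg[OF hyp] .
  obtain g where g: "geodesic_path g x y" using geodesic_pathE[OF geod] .
  define a where "a = g (gp x y z)"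
  note tri = tripod_centre[OF hyp g a_def]
  have "gp a x w + gp a y z \<le> gp a x y + gp a z w" "gp a x z + gp a y w \<le> gp a x y + gp a z w"
    using min by (simp_all add: gromov_product_def dist_commute field_simps)
  then have "gp a x w \<le> gp a z w" "gp a y w \<le> gp a z w"
    using tri(1) gp_nonneg[of a y z] gp_nonneg[of a x z] by auto
  then have w: "gp a x w \<le> 2 * \<delta>" "gp a y w \<le> 2 * \<delta>"
    using hyperbolicD[OF hyp, of a x w z] hyperbolicD[OF hyp, of a y w z] tri(2,3)
    by (auto simp: gp_commute min_def split: if_splits)
  have "dist p a \<le> R + 4 * \<delta>" if R: "gp p x y \<le> R" "gp p x z \<le> R" "gp p y z \<le> R" for p R
  proof -
    have near: "dist p a \<le> R + 4 * \<delta>"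
      if "gp a p x' \<le> 2 * \<delta>" "gp a p y' \<le> 2 * \<delta>" "gp p x' y' \<le> R" for x' y'
      using gp_through[of p x' y' a] gp_nonneg[of a x' y'] that by linarith
    have "gp a x p \<le> 2 * \<delta> \<or> gp a p y \<le> 2 * \<delta>" "gp a x p \<le> 2 * \<delta> \<or> gp a p z \<le> 2 * \<delta>"
      "gp a y p \<le> 2 * \<delta> \<or> gp a p z \<le> 2 * \<delta>"
      using hyperbolicD[OF hyp, of a x p y] hyperbolicD[OF hyp, of a x p z]
        hyperbolicD[OF hyp, of a y p z] tri \<open>0 \<le> \<delta>\<close>
      by (auto simp: min_def split: if_splits)
    then show ?thesis using near R by (auto simp: gp_commute)
  qed
  then show ?thesis using that[of a] tri w \<open>0 \<le> \<delta>\<close> by auto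
qed

text \<open>The centre \<open>b\<close> is nearly between \<open>z\<close> and every point \<open>a\<close> of a geodesic from \<open>x\<close> to \<open>y\<close>. Otherwise
  \<open>x\<close> and \<open>y\<close> would both be in directions from \<open>b\<close> different from that of \<open>a\<close>, which forces \<open>a\<close> to
  be close to \<open>b\<close>.\<close>

lemma centre_between:
  assumes hyp: "delta_hyperbolic TYPE('a::metric_space) \<delta>"
    and a: "gp a x y = 0" and b: "gp b x z \<le> 2 * \<delta>" "gp b y z \<le> 2 * \<delta>"
  shows "gp b (a::'a) z \<le> 6 * \<delta>"
proof (rule ccontr)
  assume far: "\<not> gp b a z \<le> 6 * \<delta>"
  have "0 \<le> \<delta>" using hyperbolic_constant_nonneg[OF hyp] .
  then have "gp b a x \<le> 3 * \<delta>" "gp b a y \<le> 3 * \<delta>"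
    using hyperbolicD[OF hyp, of b x a z] hyperbolicD[OF hyp, of b y a z] far b
    by (auto simp: min_def gp_commute split: if_splits)
  then have "dist a b \<le> 6 * \<delta>"
    using gp_through[of a x y b] gp_through[of b x y a] a gp_nonneg[of b x y]
    by (simp add: gromov_product_def dist_commute field_simps)
  then show False using far gp_le_dist(1)[of b a z] by (simp add: dist_commute)
qed

text \<open>When \<open>a\<close> is on the way between \<open>x1\<close> and \<open>x4\<close>, \<open>b\<close> is on the way between \<open>x2\<close> and \<open>x3\<close>, and the
  paths between the two pairs run through \<open>a\<close> and \<open>b\<close>, the cross-difference is the length of the
  bridge from \<open>a\<close> to \<open>b\<close>. It is applied both to the four points and
  to their images.\<close>

lemma cross_difference_eq_bridge:
  assumes "gp a x1 x4 \<le> c" "gp a x1 x3 \<le> c" "gp a x2 x4 \<le> c"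
    and "gp b x2 x3 \<le> c" "gp b a x2 \<le> c" "gp b a x3 \<le> c"
  shows "\<bar>cross_difference x1 x2 x3 x4 - dist a b\<bar> \<le> 4 * c"
  using assms gp_through[of a x2 x3 b] cross_difference_gp[of x1 x2 x3 x4 a]
    gp_nonneg[of a x1 x4] gp_nonneg[of a x1 x3] gp_nonneg[of a x2 x4]
    gp_nonneg[of b x2 x3] gp_nonneg[of b a x2] gp_nonneg[of b a x3]
  by linarith

text \<open>The four points span an approximate tree whose shape is decided by the smallest of the three
  sums of opposite distances. If this is the sum that pairs 1 with 4, the cross-difference is the
  length of the bridge between the two branch points \<open>a\<close> and \<open>b\<close>; the images of \<open>a\<close> and \<open>b\<close> are
  approximate branch points for the image configuration by \<open>sublinear_stability\<close>, and the map
  distorts the bridge by its biLipschitz bounds. In the two other shapes there is a branch point at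
  which both positive terms of the cross-difference are small, before and after applying \<open>f\<close>. The
  branch points are within \<open>R + 4 \<delta>\<close> of \<open>p\<close>, so all errors are \<open>O(u R)\<close>.\<close>

lemma cross_difference_distortion:
  fixes p :: "'a::metric_space" and f :: "'a \<Rightarrow> 'b::metric_space"
  assumes u: "admissible u" and l: "0 < l" and L: "0 < L"
    and geoa: "geodesic_space TYPE('a)" and geob: "geodesic_space TYPE('b)"
    and hypa: "delta_hyperbolic TYPE('a) \<delta>" and hypb: "delta_hyperbolic TYPE('b) \<delta>"
    and C: "0 \<le> C" and f: "sublinear_biLipschitz_bounds p l L (\<lambda>r. C * u r) f"
  obtains K where "0 \<le> K"
    "\<And>x1 x2 x3 x4 R. \<lbrakk>0 \<le> R; gp p x1 x2 \<le> R; gp p x1 x3 \<le> R; gp p x1 x4 \<le> R;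
        gp p x2 x3 \<le> R; gp p x2 x4 \<le> R; gp p x3 x4 \<le> R\<rbrakk> \<Longrightarrow>
      l * max 0 (cross_difference x1 x2 x3 x4) - K * u R
        \<le> max 0 (cross_difference (f x1) (f x2) (f x3) (f x4)) \<and>
      max 0 (cross_difference (f x1) (f x2) (f x3) (f x4))
        \<le> L * max 0 (cross_difference x1 x2 x3 x4) + K * u R"
proof -
  have "0 \<le> \<delta>" using hyperbolic_constant_nonneg[OF hypa] .
  then have "0 \<le> 6 * \<delta>" by simp
  then obtain K0 where K0: "0 \<le> K0"
    "\<And>m x y. gp m x y \<le> 6 * \<delta> \<Longrightarrow> gp (f m) (f x) (f y) \<le> K0 * u (dist p m)"
    using sublinear_stability[OF u l L geoa geob hypa hypb C f] by metis
  have "0 \<le> 4 * \<delta>" using \<open>0 \<le> \<delta>\<close> by simp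
  then obtain B where B: "1 \<le> B" "\<And>r. 0 \<le> r \<Longrightarrow> u (r + 4 * \<delta>) \<le> B * u r"
    using admissible_shift[OF u] by blast
  define K where "K = 4 * K0 * B + C * B + 24 * \<delta> * (l + L)"
  have K: "0 \<le> K" unfolding K_def using K0 B C l L \<open>0 \<le> \<delta>\<close>
    by (intro add_nonneg_nonneg mult_nonneg_nonneg) auto
  have "l * max 0 (cross_difference x1 x2 x3 x4) - K * u R
        \<le> max 0 (cross_difference (f x1) (f x2) (f x3) (f x4)) \<and>
      max 0 (cross_difference (f x1) (f x2) (f x3) (f x4))
        \<le> L * max 0 (cross_difference x1 x2 x3 x4) + K * u R"
    if R0: "0 \<le> R" and R: "gp p x1 x2 \<le> R" "gp p x1 x3 \<le> R" "gp p x1 x4 \<le> R"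
        "gp p x2 x3 \<le> R" "gp p x2 x4 \<le> R" "gp p x3 x4 \<le> R" for x1 x2 x3 x4 R
  proof -
    define S where "S = cross_difference x1 x2 x3 x4"
    define S' where "S' = cross_difference (f x1) (f x2) (f x3) (f x4)"
    have uR: "1 \<le> u R" using admissible_ge_1[OF u R0] .
    define e where "e = K0 * B * u R"
    have e: "0 \<le> e" using K0 B uR by (simp add: e_def)
    have stab: "gp (f a) (f x) (f y) \<le> e" if "gp a x y \<le> 6 * \<delta>" "dist p a \<le> R + 4 * \<delta>" for a x y
    proof -
      have "u (dist p a) \<le> u (R + 4 * \<delta>)" by (rule admissible_mono[OF u _ that(2)]) simp
      then have "u (dist p a) \<le> B * u R" using B(2)[OF R0] by simp
      then have "K0 * u (dist p a) \<le> K0 * (B * u R)" using K0 by (intro mult_left_mono)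
      then show ?thesis using K0(2)[OF that(1)] by (simp add: e_def mult.assoc)
    qed
    have \<delta>u: "\<delta> * X \<le> \<delta> * X * u R" if "0 \<le> X" for X
      using mult_left_mono[OF uR, of "\<delta> * X"] \<open>0 \<le> \<delta>\<close> that by simp
    have KuR: "K * u R = 4 * e + C * (B * u R) + 24 * (\<delta> * l * u R) + 24 * (\<delta> * L * u R)"
      by (simp add: K_def e_def algebra_simps)
    have nn: "0 \<le> \<delta> * l * u R" "0 \<le> \<delta> * L * u R" using \<open>0 \<le> \<delta>\<close> l L uR by auto
    have CB: "0 \<le> C * (B * u R)" using C B uR by simp
    \<comment> \<open>The two shapes in which the bridge does not join the pairs 1, 4 and 2, 3: both positive parts
      are then within the error.\<close>
    have small: ?thesis
      if a: "gp a x1 x4 \<le> 2 * \<delta>" "gp a x2 x3 \<le> 2 * \<delta>" "dist p a \<le> R + 4 * \<delta>" for a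
    proof -
      have "S \<le> 4 * \<delta>" using cross_difference_le[of x1 x2 x3 x4 a] a by (simp add: S_def)
      then have "l * max 0 S \<le> l * (4 * \<delta>)" using l \<open>0 \<le> \<delta>\<close> by (intro mult_left_mono) auto
      also have "\<dots> \<le> 24 * (\<delta> * l)" using l \<open>0 \<le> \<delta>\<close> by (simp add: mult.commute)
      finally have 1: "l * max 0 S \<le> K * u R"
        using \<delta>u[of l] l e CB nn unfolding KuR by linarith
      have "gp (f a) (f x1) (f x4) \<le> e" "gp (f a) (f x2) (f x3) \<le> e"
        using a \<open>0 \<le> \<delta>\<close> by (auto intro!: stab)
      then have "S' \<le> 2 * e"
        using cross_difference_le[of "f x1" "f x2" "f x3" "f x4" "f a"] by (simp add: S'_def)
      then have "max 0 S' \<le> K * u R"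
        using e CB nn unfolding KuR by linarith
      moreover have "0 \<le> L * max 0 S" using L by simp
      ultimately show ?thesis using 1 unfolding S_def S'_def by linarith
    qed
    consider (12) "dist x1 x2 + dist x3 x4 \<le> dist x1 x3 + dist x2 x4"
        "dist x1 x2 + dist x3 x4 \<le> dist x1 x4 + dist x2 x3"
      | (13) "dist x1 x3 + dist x2 x4 \<le> dist x1 x2 + dist x3 x4"
        "dist x1 x3 + dist x2 x4 \<le> dist x1 x4 + dist x2 x3"
      | (14) "dist x1 x4 + dist x2 x3 \<le> dist x1 x2 + dist x3 x4"
        "dist x1 x4 + dist x2 x3 \<le> dist x1 x3 + dist x2 x4"
      by linarith
    then show ?thesis
    proof cases
      case 12
      then obtain a where a: "gp a x1 x4 \<le> 2 * \<delta>" "gp a x2 x3 \<le> 2 * \<delta>"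
        "\<And>p R. \<lbrakk>gp p x1 x2 \<le> R; gp p x1 x3 \<le> R; gp p x2 x3 \<le> R\<rbrakk> \<Longrightarrow> dist p a \<le> R + 4 * \<delta>"
        using four_point_centre[OF hypa geoa, of x1 x2 x3 x4] by metis
      show ?thesis by (rule small[OF a(1,2)]) (intro a R)
    next
      case 13
      then obtain a where a: "gp a x1 x4 \<le> 2 * \<delta>" "gp a x3 x2 \<le> 2 * \<delta>"
        "\<And>p R. \<lbrakk>gp p x1 x3 \<le> R; gp p x1 x2 \<le> R; gp p x3 x2 \<le> R\<rbrakk> \<Longrightarrow> dist p a \<le> R + 4 * \<delta>"
        using four_point_centre[OF hypa geoa, of x1 x3 x2 x4] by (metis dist_commute)
      show ?thesis
        by (rule small[OF a(1)]) (use a R in \<open>auto simp: gp_commute\<close>)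
    next
      case 14
      obtain a where a: "gp a x1 x4 = 0" "gp a x1 x2 \<le> 2 * \<delta>" "gp a x4 x2 \<le> 2 * \<delta>"
        "gp a x1 x3 \<le> 2 * \<delta>" "gp a x4 x3 \<le> 2 * \<delta>"
        "\<And>p R. \<lbrakk>gp p x1 x4 \<le> R; gp p x1 x2 \<le> R; gp p x4 x2 \<le> R\<rbrakk> \<Longrightarrow> dist p a \<le> R + 4 * \<delta>"
        using four_point_centre[OF hypa geoa, of x1 x4 x2 x3] 14 by (metis dist_commute)
      obtain b where b: "gp b x2 x3 = 0" "gp b x2 x1 \<le> 2 * \<delta>" "gp b x3 x1 \<le> 2 * \<delta>"
        "gp b x2 x4 \<le> 2 * \<delta>" "gp b x3 x4 \<le> 2 * \<delta>"
        "\<And>p R. \<lbrakk>gp p x2 x3 \<le> R; gp p x2 x1 \<le> R; gp p x3 x1 \<le> R\<rbrakk> \<Longrightarrow> dist p b \<le> R + 4 * \<delta>"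
        using four_point_centre[OF hypa geoa, of x2 x3 x1 x4] 14 by (metis dist_commute add.commute)
      have pa: "dist p a \<le> R + 4 * \<delta>" by (intro a) (use R in \<open>auto simp: gp_commute\<close>)
      have pb: "dist p b \<le> R + 4 * \<delta>" by (intro b) (use R in \<open>auto simp: gp_commute\<close>)
      have ba: "gp b a x2 \<le> 6 * \<delta>" "gp b a x3 \<le> 6 * \<delta>"
        using b by (auto intro!: centre_between[OF hypa a(1)] simp: gp_commute)
      have xs: "gp a x1 x4 \<le> 6 * \<delta>" "gp a x1 x3 \<le> 6 * \<delta>" "gp a x2 x4 \<le> 6 * \<delta>" "gp b x2 x3 \<le> 6 * \<delta>"
        using a b \<open>0 \<le> \<delta>\<close> by (auto simp: gp_commute)
      have S: "\<bar>S - dist a b\<bar> \<le> 24 * \<delta>"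
        using cross_difference_eq_bridge[OF xs ba] by (simp add: S_def)
      have S': "\<bar>S' - dist (f a) (f b)\<bar> \<le> 4 * e"
        unfolding S'_def by (intro cross_difference_eq_bridge stab xs ba pa pb)
      have "C * u (R + 4 * \<delta>) \<le> C * (B * u R)" using B(2)[OF R0] C by (rule mult_left_mono)
      then have ab: "l * dist a b - C * (B * u R) \<le> dist (f a) (f b)"
        "dist (f a) (f b) \<le> L * dist a b + C * (B * u R)"
        using sublinear_biLipschitz_boundsD[OF f pa pb] by linarith+
      have "L * dist a b \<le> L * (S + 24 * \<delta>)" using S L by (intro mult_left_mono) auto
      moreover have "L * (S + 24 * \<delta>) = L * S + 24 * (\<delta> * L)" by (simp add: algebra_simps)
      ultimately have "S' \<le> L * S + K * u R"
        using S' ab \<delta>u[of L] L nn unfolding KuR by linarith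
      moreover have "L * S \<le> L * max 0 S" using L by (intro mult_left_mono) auto
      moreover have "0 \<le> L * max 0 S" "0 \<le> K * u R" using L K uR by auto
      ultimately have up: "max 0 S' \<le> L * max 0 S + K * u R" by linarith
      have "l * (S - 24 * \<delta>) \<le> l * dist a b" using S l by (intro mult_left_mono) auto
      moreover have "l * (S - 24 * \<delta>) = l * S - 24 * (\<delta> * l)" by (simp add: algebra_simps)
      ultimately have "l * S - K * u R \<le> S'"
        using S' ab \<delta>u[of l] l nn unfolding KuR by linarith
      then have "l * max 0 S - K * u R \<le> max 0 S'"
        using \<open>0 \<le> K * u R\<close> by (auto simp: max_def)
      then show ?thesis using up by (simp add: S_def S'_def)
    qed
  qed
  then show ?thesis using that K by blast
qed

section \<open>The boundary and its products\<close>

lemma gromov_seq_iff: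
  "gromov_seq p x \<longleftrightarrow> (\<forall>c. \<exists>N. \<forall>n\<ge>N. \<forall>m\<ge>N. c \<le> gp p (x n) (x m))"
  unfolding gromov_seq_def filterlim_at_top eventually_prod_sequentially by (simp, blast)

lemma gromov_rel_iff:
  "(x, y) \<in> gromov_rel p \<longleftrightarrow>
     gromov_seq p x \<and> gromov_seq p y \<and> (\<forall>c. \<exists>N. \<forall>n\<ge>N. c \<le> gp p (x n) (y n))"
  unfolding gromov_rel_def filterlim_at_top eventually_sequentially by simp

lemma gromov_rel_joint:
  assumes hyp: "delta_hyperbolic TYPE('a::metric_space) \<delta>" and xy: "(x, y) \<in> gromov_rel (p::'a)"
  shows "\<exists>N. \<forall>n\<ge>N. \<forall>m\<ge>N. c \<le> gp p (x n) (y m)"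
proof -
  obtain N1 where N1: "\<And>n m. n \<ge> N1 \<Longrightarrow> m \<ge> N1 \<Longrightarrow> c + \<delta> \<le> gp p (x n) (x m)"
    using xy unfolding gromov_rel_iff gromov_seq_iff by meson
  obtain N2 where N2: "\<And>n. n \<ge> N2 \<Longrightarrow> c + \<delta> \<le> gp p (x n) (y n)"
    using xy unfolding gromov_rel_iff by meson
  have "c \<le> gp p (x n) (y m)" if "n \<ge> max N1 N2" "m \<ge> max N1 N2" for n m
    using hyperbolicD[OF hyp, of p "x n" "x m" "y m"] N1[of n m] N2[of m] that
    by (auto simp: min_def split: if_splits)
  then show ?thesis by blast
qed

lemma equiv_gromov_rel:
  assumes hyp: "delta_hyperbolic TYPE('a::metric_space) \<delta>"
  shows "equiv {x. gromov_seq p x} (gromov_rel (p::'a))"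
proof (rule equivI)
  show "gromov_rel p \<subseteq> {x. gromov_seq p x} \<times> {x. gromov_seq p x}" by (auto simp: gromov_rel_iff)
  show "refl_on {x. gromov_seq p x} (gromov_rel p)"
    by (rule refl_onI) (simp add: gromov_rel_iff gromov_seq_iff, blast)
  show "sym (gromov_rel p)" by (rule symI) (auto simp: gromov_rel_iff gp_commute)
  show "trans (gromov_rel p)"
  proof (rule transI)
    fix x y z assume xy: "(x, y) \<in> gromov_rel p" and yz: "(y, z) \<in> gromov_rel p"
    have "\<exists>N. \<forall>n\<ge>N. c \<le> gp p (x n) (z n)" for c
    proof -
      obtain N1 where N1: "\<And>n. n \<ge> N1 \<Longrightarrow> c + \<delta> \<le> gp p (x n) (y n)"
        using xy unfolding gromov_rel_iff by meson
      obtain N2 where N2: "\<And>n. n \<ge> N2 \<Longrightarrow> c + \<delta> \<le> gp p (y n) (z n)"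
        using yz unfolding gromov_rel_iff by meson
      have "c \<le> gp p (x n) (z n)" if "n \<ge> max N1 N2" for n
        using hyperbolicD[OF hyp, of p "x n" "y n" "z n"] N1[of n] N2[of n] that
        by (auto simp: min_def split: if_splits)
      then show ?thesis by blast
    qed
    then show "(x, z) \<in> gromov_rel p" using xy yz by (auto simp: gromov_rel_iff)
  qed
qed

lemma boundary_member_rel:
  assumes hyp: "delta_hyperbolic TYPE('a::metric_space) \<delta>" and "\<xi> \<in> boundary (p::'a)" "x \<in> \<xi>" "y \<in> \<xi>"
  shows "(x, y) \<in> gromov_rel p"
  using quotient_eq_iff[OF equiv_gromov_rel[OF hyp], of \<xi> p \<xi> x y] assms(2-)
  by (simp add: boundary_def)

lemma boundary_member_seq:
  assumes hyp: "delta_hyperbolic TYPE('a::metric_space) \<delta>" and "\<xi> \<in> boundary (p::'a)" "x \<in> \<xi>"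
  shows "gromov_seq p x"
  using boundary_member_rel[OF assms assms(3)] by (simp add: gromov_rel_iff)

lemma boundary_nonempty:
  assumes hyp: "delta_hyperbolic TYPE('a::metric_space) \<delta>" and "\<xi> \<in> boundary (p::'a)"
  obtains x where "x \<in> \<xi>"
  using in_quotient_imp_non_empty[OF equiv_gromov_rel[OF hyp]] assms(2) unfolding boundary_def by blast

lemma boundary_eq_class:
  assumes hyp: "delta_hyperbolic TYPE('a::metric_space) \<delta>" and "\<xi> \<in> boundary (p::'a)" "x \<in> \<xi>"
  shows "\<xi> = gromov_rel p `` {x}"
proof -
  obtain x' where x': "\<xi> = gromov_rel p `` {x'}" using assms(2) unfolding boundary_def by (rule quotientE)
  then have "(x', x) \<in> gromov_rel p" using assms(3) by simp
  then show ?thesis using equiv_class_eq[OF equiv_gromov_rel[OF hyp]] x' by simp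
qed

lemma boundary_distinct_not_rel:
  assumes hyp: "delta_hyperbolic TYPE('a::metric_space) \<delta>" and "\<xi> \<in> boundary (p::'a)" "\<eta> \<in> boundary p"
    and "\<xi> \<noteq> \<eta>" "x \<in> \<xi>" "y \<in> \<eta>"
  shows "(x, y) \<notin> gromov_rel p"
  using quotient_eq_iff[OF equiv_gromov_rel[OF hyp], of \<xi> p \<eta> x y] assms(2-)
  by (simp add: boundary_def)

lemma boundary_product_le:
  "x \<in> \<xi> \<Longrightarrow> y \<in> \<eta> \<Longrightarrow> boundary_product p \<xi> \<eta> \<le> liminf (\<lambda>n. ereal (gp p (x n) (y n)))"
  unfolding boundary_product_def by (rule INF_lower2[of "(x, y)"]) auto

lemma boundary_product_nonneg: "0 \<le> boundary_product p \<xi> \<eta>"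
  unfolding boundary_product_def
  by (rule INF_greatest) (auto intro!: Liminf_bounded simp: gp_nonneg)

text \<open>Inserting one fixed representative of \<open>\<zeta>\<close> between arbitrary representatives of \<open>\<xi>\<close> and \<open>\<eta>\<close>
  passes the four-point inequality to the boundary with the same constant. That no loss occurs
  matters: for the base \<open>2 powr (1 / \<delta>)\<close> it yields the quasi-ultrametric constant 2, the largest one
  for which chain sums bound the weight from above as in \<open>chain_inequality\<close>.\<close>

lemma boundary_product_hyperbolic:
  assumes hyp: "delta_hyperbolic TYPE('a::metric_space) \<delta>" and \<zeta>: "\<zeta> \<in> boundary (p::'a)"
  shows "min (boundary_product p \<xi> \<zeta>) (boundary_product p \<zeta> \<eta>) \<le> boundary_product p \<xi> \<eta> + ereal \<delta>"
proof -
  obtain z where z: "z \<in> \<zeta>" using boundary_nonempty[OF hyp \<zeta>] .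
  have "min (boundary_product p \<xi> \<zeta>) (boundary_product p \<zeta> \<eta>) - ereal \<delta>
      \<le> liminf (\<lambda>n. ereal (gp p (x n) (y n)))" if xy: "x \<in> \<xi>" "y \<in> \<eta>" for x y
  proof -
    have "min (boundary_product p \<xi> \<zeta>) (boundary_product p \<zeta> \<eta>) - ereal \<delta>
        \<le> min (liminf (\<lambda>n. ereal (gp p (x n) (z n)))) (liminf (\<lambda>n. ereal (gp p (z n) (y n)))) - ereal \<delta>"
      by (intro ereal_minus_mono min.mono boundary_product_le xy z) auto
    also have "\<dots> \<le> liminf (\<lambda>n. ereal (gp p (x n) (y n)))"
    proof (subst le_Liminf_iff, intro allI impI)
      fix c :: ereal
      assume "c < min (liminf (\<lambda>n. ereal (gp p (x n) (z n)))) (liminf (\<lambda>n. ereal (gp p (z n) (y n)))) - ereal \<delta>"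
      then have "c + ereal \<delta> < min (liminf (\<lambda>n. ereal (gp p (x n) (z n)))) (liminf (\<lambda>n. ereal (gp p (z n) (y n))))"
        by (simp add: ereal_less_minus)
      then have "eventually (\<lambda>n. c + ereal \<delta> < ereal (gp p (x n) (z n))) sequentially"
        "eventually (\<lambda>n. c + ereal \<delta> < ereal (gp p (z n) (y n))) sequentially"
        by (auto intro: less_LiminfD)
      then show "eventually (\<lambda>n. c < ereal (gp p (x n) (y n))) sequentially"
      proof eventually_elim
        case (elim n)
        then show ?case using hyperbolicD[OF hyp, of p "x n" "z n" "y n"]
          by (cases c) (auto simp: min_def split: if_splits)
      qed
    qed
    finally show ?thesis .
  qed
  then have "min (boundary_product p \<xi> \<zeta>) (boundary_product p \<zeta> \<eta>) - ereal \<delta> \<le> boundary_product p \<xi> \<eta>"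
    unfolding boundary_product_def[of p \<xi> \<eta>] by (intro INF_greatest) auto
  then show ?thesis by (simp add: ereal_minus_le)
qed

lemma boundary_product_self:
  assumes hyp: "delta_hyperbolic TYPE('a::metric_space) \<delta>" and \<xi>: "\<xi> \<in> boundary (p::'a)"
  shows "boundary_product p \<xi> \<xi> = \<infinity>"
proof -
  have "liminf (\<lambda>n. ereal (gp p (x n) (y n))) = \<infinity>" if xy: "x \<in> \<xi>" "y \<in> \<xi>" for x y
  proof -
    have "filterlim (\<lambda>n. gp p (x n) (y n)) at_top sequentially"
      using boundary_member_rel[OF hyp \<xi> xy] by (simp add: gromov_rel_def)
    then have "((\<lambda>n. ereal (gp p (x n) (y n))) \<longlongrightarrow> \<infinity>) sequentially"
      by (simp add: tendsto_PInfty_eq_at_top)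
    then show ?thesis by (intro lim_imp_Liminf) auto
  qed
  then show ?thesis unfolding boundary_product_def
    by (intro order.antisym INF_greatest) auto
qed

lemma boundary_product_finite:
  assumes hyp: "delta_hyperbolic TYPE('a::metric_space) \<delta>" and \<xi>: "\<xi> \<in> boundary (p::'a)" "\<eta> \<in> boundary p"
    and ne: "\<xi> \<noteq> \<eta>"
  shows "\<bar>boundary_product p \<xi> \<eta>\<bar> \<noteq> \<infinity>"
proof -
  obtain x where x: "x \<in> \<xi>" using boundary_nonempty[OF hyp \<xi>(1)] .
  obtain y where y: "y \<in> \<eta>" using boundary_nonempty[OF hyp \<xi>(2)] .
  have "boundary_product p \<xi> \<eta> \<noteq> \<infinity>"
  proof
    assume "boundary_product p \<xi> \<eta> = \<infinity>"
    then have "liminf (\<lambda>n. ereal (gp p (x n) (y n))) = \<infinity>"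
      using boundary_product_le[OF x y, of p] by simp
    then have "filterlim (\<lambda>n. gp p (x n) (y n)) at_top sequentially"
      unfolding tendsto_PInfty_eq_at_top[symmetric] by (rule iffD2[OF Liminf_PInfty[OF sequentially_bot]])
    then have "(x, y) \<in> gromov_rel p"
      using boundary_member_seq[OF hyp \<xi>(1) x] boundary_member_seq[OF hyp \<xi>(2) y]
      by (simp add: gromov_rel_def)
    then show False using boundary_distinct_not_rel[OF hyp \<xi> ne x y] by simp
  qed
  then show ?thesis using boundary_product_nonneg[of p \<xi> \<eta>] by auto
qed

text \<open>Used for distinct boundary points, where the product is finite.\<close>

abbreviation real_product :: "'a::metric_space \<Rightarrow> (nat \<Rightarrow> 'a) set \<Rightarrow> (nat \<Rightarrow> 'a) set \<Rightarrow> real" where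
  "real_product p \<xi> \<eta> \<equiv> real_of_ereal (boundary_product p \<xi> \<eta>)"

text \<open>Products along any representatives have upper limit at most \<open>2 \<delta>\<close> above the infimum over all
  representatives: compare with representatives that almost realise the infimum. So every choice of
  representatives computes the boundary product up to a constant.\<close>

lemma boundary_product_approx:
  assumes hyp: "delta_hyperbolic TYPE('a::metric_space) \<delta>" and \<xi>: "\<xi> \<in> boundary (p::'a)" "\<eta> \<in> boundary p"
    and ne: "\<xi> \<noteq> \<eta>" and x: "x \<in> \<xi>" and y: "y \<in> \<eta>"
  shows "eventually (\<lambda>n. \<bar>gp p (x n) (y n) - real_product p \<xi> \<eta>\<bar> \<le> 2 * \<delta> + 1) sequentially"
proof -
  have "0 \<le> \<delta>" using hyperbolic_constant_nonneg[OF hyp] .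
  define P where "P = real_product p \<xi> \<eta>"
  have P: "boundary_product p \<xi> \<eta> = ereal P"
    using boundary_product_finite[OF hyp \<xi> ne] by (simp add: P_def ereal_real')
  have "ereal (P - 1) < liminf (\<lambda>n. ereal (gp p (x n) (y n)))"
    using boundary_product_le[OF x y, of p] by (simp add: P less_le_trans[of _ "ereal P"])
  then have lower: "eventually (\<lambda>n. P - 1 < gp p (x n) (y n)) sequentially"
    using less_LiminfD by fastforce
  have "boundary_product p \<xi> \<eta> < ereal (P + 1)" by (simp add: P)
  then obtain x' y' where xy': "x' \<in> \<xi>" "y' \<in> \<eta>"
    "liminf (\<lambda>n. ereal (gp p (x' n) (y' n))) < ereal (P + 1)"
    unfolding boundary_product_def INF_less_iff by auto
  have freq: "\<exists>n\<ge>N. gp p (x' n) (y' n) < P + 1" for N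
  proof (rule ccontr)
    assume "\<not> ?thesis"
    then have "eventually (\<lambda>n. ereal (P + 1) \<le> ereal (gp p (x' n) (y' n))) sequentially"
      unfolding eventually_sequentially by (auto intro!: exI[of _ N] simp: not_less)
    then have "ereal (P + 1) \<le> liminf (\<lambda>n. ereal (gp p (x' n) (y' n)))" by (rule Liminf_bounded)
    then show False using xy'(3) by simp
  qed
  obtain N1 where N1: "\<And>n m. n \<ge> N1 \<Longrightarrow> m \<ge> N1 \<Longrightarrow> P + 2 * \<delta> + 1 \<le> gp p (x' n) (x m)"
    using gromov_rel_joint[OF hyp boundary_member_rel[OF hyp \<xi>(1) xy'(1) x]] by meson
  obtain N2 where N2: "\<And>n m. n \<ge> N2 \<Longrightarrow> m \<ge> N2 \<Longrightarrow> P + 2 * \<delta> + 1 \<le> gp p (y m) (y' n)"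
    using gromov_rel_joint[OF hyp boundary_member_rel[OF hyp \<xi>(2) y xy'(2)]] by meson
  obtain n where n: "n \<ge> max N1 N2" "gp p (x' n) (y' n) < P + 1" using freq by blast
  have upper: "gp p (x m) (y m) \<le> P + 1 + 2 * \<delta>" if "m \<ge> max N1 N2" for m
    using hyperbolicD2[OF hyp, of p "x' n" "x m" "y m" "y' n"] N1[of n m] N2[of n m] n that
    by (auto simp: min_def split: if_splits)
  have "eventually (\<lambda>m. m \<ge> max N1 N2) sequentially" by (rule eventually_ge_at_top)
  with lower show ?thesis
  proof eventually_elim
    case (elim m)
    show ?case unfolding P_def[symmetric] using upper[OF elim(2)] elim(1) \<open>0 \<le> \<delta>\<close> by linarith
  qed
qed

section \<open>Visual distances and cross-ratios\<close>

text \<open>Frink's chain argument. The induction proves the sharper bound \<open>key\<close>, in which the two extreme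
  links count half. Let the distance to the end of the chain drop below half of the total \<open>D\<close> between
  the places \<open>k\<close> and \<open>Suc k\<close>; then \<open>D\<close> is at most twice the distance from the start to
  \<open>Suc k\<close> and at most twice the distance from \<open>k\<close> to the end. Averaging the two induction
  hypotheses counts the link at \<open>k\<close>, extreme in both parts, exactly as often as an inner link.\<close>

lemma chain_inequality:
  fixes \<rho> :: "'x \<Rightarrow> 'x \<Rightarrow> real"
  assumes nonneg: "\<And>x y. 0 \<le> \<rho> x y" and refl: "\<And>x. x \<in> S \<Longrightarrow> \<rho> x x = 0"
    and quasi: "\<And>x y z. \<lbrakk>x \<in> S; y \<in> S; z \<in> S\<rbrakk> \<Longrightarrow> \<rho> x z \<le> 2 * max (\<rho> x y) (\<rho> y z)"
    and n: "1 \<le> n" and S: "\<And>i. i \<le> n \<Longrightarrow> \<zeta> i \<in> S"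
  shows "\<rho> (\<zeta> 0) (\<zeta> n) \<le> 4 * (\<Sum>k<n. \<rho> (\<zeta> k) (\<zeta> (Suc k)))"
proof -
  define s where "s k = \<rho> (\<zeta> k) (\<zeta> (Suc k))" for k
  have s0: "0 \<le> s k" for k using nonneg by (simp add: s_def)
  have key: "\<rho> (\<zeta> i) (\<zeta> j) \<le> 4 * sum s {i..<j} - 2 * s i - 2 * s (j - 1)"
    if "i + 2 \<le> j" "j \<le> n" for i j
    using that
  proof (induction "j - i" arbitrary: i j rule: less_induct)
    case less
    define D where "D = \<rho> (\<zeta> i) (\<zeta> j)"
    have ij: "i < j" using less.prems by simp
    have split: "sum s {a..<c} = sum s {a..<b} + sum s {b..<c}" if "a \<le> b" "b \<le> c" for a b c
      using sum.atLeastLessThan_concat[OF that, of s] by simp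
    have ends: "4 * sum s {i..<j} - 2 * s i - 2 * s (j - 1) = 2 * s i + 2 * s (j - 1) + 4 * sum s {Suc i..<j - 1}"
    proof -
      have "sum s {i..<j} = sum s {i..<Suc i} + (sum s {Suc i..<j - 1} + sum s {j - 1..<Suc (j - 1)})"
        using split[of i "Suc i" j] split[of "Suc i" "j - 1" j] less.prems by simp
      then show ?thesis by simp
    qed
    have mid0: "0 \<le> sum s {Suc i..<j - 1}" by (intro sum_nonneg s0)
    have bound0: "0 \<le> 4 * sum s {i..<j} - 2 * s i - 2 * s (j - 1)"
      unfolding ends using s0[of i] s0[of "j - 1"] mid0 by simp
    show ?case
    proof (cases "D = 0")
      case True
      then show ?thesis using bound0 by (simp add: D_def)
    next
      case False
      then have D: "0 < D" using nonneg[of "\<zeta> i" "\<zeta> j"] by (simp add: D_def)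
      define Q where "Q k \<longleftrightarrow> D \<le> 2 * \<rho> (\<zeta> k) (\<zeta> j)" for k
      have "Q i" using D by (simp add: Q_def D_def)
      moreover have "\<not> Q j" using D refl[OF S[of j]] less.prems by (simp add: Q_def)
      ultimately obtain k where k: "i \<le> k" "k < j" "Q k" "\<not> Q (Suc k)"
      proof -
        have "\<exists>k. i \<le> k \<and> k < j \<and> Q k \<and> \<not> Q (Suc k)"
        proof (rule ccontr)
          assume *: "\<not> ?thesis"
          have "k \<le> j \<longrightarrow> Q k" if "i \<le> k" for k
            using that by (induction k rule: dec_induct) (use \<open>Q i\<close> * in auto)
          then show False using \<open>\<not> Q j\<close> ij by auto
        qed
        then show ?thesis using that by blast
      qed
      have right: "D \<le> 2 * \<rho> (\<zeta> k) (\<zeta> j)" using k(3) by (simp add: Q_def)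
      have left: "D \<le> 2 * \<rho> (\<zeta> i) (\<zeta> (Suc k))"
        using quasi[of "\<zeta> i" "\<zeta> (Suc k)" "\<zeta> j"] S less.prems k by (auto simp: Q_def D_def max_def split: if_splits)
      consider "k = i" | "k = j - 1" | "i < k" "k < j - 1" using k by linarith
      then show ?thesis
      proof cases
        case 1
        then have "D \<le> 2 * s i" using left by (simp add: s_def)
        then show ?thesis unfolding ends using s0[of "j - 1"] mid0 by (simp add: D_def)
      next
        case 2
        then have "D \<le> 2 * s (j - 1)" using right k by (simp add: s_def)
        then show ?thesis unfolding ends using s0[of i] mid0 by (simp add: D_def)
      next
        case 3
        have 1: "\<rho> (\<zeta> i) (\<zeta> (Suc k)) \<le> 4 * sum s {i..<Suc k} - 2 * s i - 2 * s (Suc k - 1)"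
          by (rule less.hyps) (use 3 less.prems in auto)
        have 2: "\<rho> (\<zeta> k) (\<zeta> j) \<le> 4 * sum s {k..<j} - 2 * s k - 2 * s (j - 1)"
          by (rule less.hyps) (use 3 less.prems in auto)
        have "sum s {i..<Suc k} + sum s {k..<j} = sum s {i..<j} + s k"
          using split[of i k j] 3 by simp
        then show ?thesis using 1 2 left right unfolding D_def[symmetric] by simp
      qed
    qed
  qed
  have s_sum: "(\<Sum>k<n. \<rho> (\<zeta> k) (\<zeta> (Suc k))) = sum s {0..<n}" by (simp add: s_def atLeast0LessThan)
  show ?thesis
  proof (cases "n = 1")
    case True
    then show ?thesis using nonneg by simp
  next
    case False
    then show ?thesis using key[of 0 n] n s0[of 0] s0[of "n - 1"] unfolding s_sum by simp
  qed
qed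

lemma visual_base_gt_1: "1 < visual_base \<delta>"
  by (simp add: visual_base_def)

lemma visual_base_powr_le_2:
  assumes "0 \<le> \<delta>"
  shows "visual_base \<delta> powr \<delta> \<le> 2"
  using assms by (auto simp: visual_base_def powr_powr)

lemma visual_weight_distinct:
  assumes "delta_hyperbolic TYPE('a::metric_space) \<delta>" "\<xi> \<in> boundary (p::'a)" "\<eta> \<in> boundary p" "\<xi> \<noteq> \<eta>"
  shows "visual_weight p \<mu> \<xi> \<eta> = \<mu> powr (- real_product p \<xi> \<eta>)"
  using boundary_product_finite[OF assms] by (auto simp: visual_weight_def)

text \<open>Raising \<open>\<mu>\<close> to the power given by the four-point inequality costs the factor
  \<open>\<mu> powr \<delta> \<le> 2\<close>; this is what the choice of the visual base is made for.\<close>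

lemma visual_weight_quasi_ultrametric:
  assumes hyp: "delta_hyperbolic TYPE('a::metric_space) \<delta>" and \<zeta>: "\<zeta> \<in> boundary (p::'a)"
    and \<mu>: "\<mu> = visual_base \<delta>"
  shows "visual_weight p \<mu> \<xi> \<eta> \<le> 2 * max (visual_weight p \<mu> \<xi> \<zeta>) (visual_weight p \<mu> \<zeta> \<eta>)"
proof -
  have \<mu>1: "1 < \<mu>" using visual_base_gt_1 by (simp add: \<mu>)
  have \<mu>\<delta>: "\<mu> powr \<delta> \<le> 2"
    using visual_base_powr_le_2[OF hyperbolic_constant_nonneg[OF hyp]] by (simp add: \<mu>)
  have nn: "0 \<le> visual_weight p \<mu> \<xi> \<eta>" for \<xi> \<eta> by (simp add: visual_weight_def)
  have step: "visual_weight p \<mu> \<xi> \<eta> \<le> 2 * visual_weight p \<mu> \<xi>' \<eta>'"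
    if le: "boundary_product p \<xi>' \<eta>' \<le> boundary_product p \<xi> \<eta> + ereal \<delta>" for \<xi>' \<eta>'
  proof (cases "boundary_product p \<xi> \<eta> = \<infinity>")
    case True
    then show ?thesis using nn[of \<xi>' \<eta>'] by (simp add: visual_weight_def)
  next
    case False
    then obtain P where P: "boundary_product p \<xi> \<eta> = ereal P"
      using boundary_product_nonneg[of p \<xi> \<eta>] by (cases "boundary_product p \<xi> \<eta>") auto
    then obtain P' where P': "boundary_product p \<xi>' \<eta>' = ereal P'"
      using boundary_product_nonneg[of p \<xi>' \<eta>'] le by (cases "boundary_product p \<xi>' \<eta>'") auto
    have "\<mu> powr (- P) \<le> \<mu> powr (\<delta> + - P')" using \<mu>1 le P P' by (intro powr_mono) auto
    also have "\<dots> = \<mu> powr \<delta> * \<mu> powr (- P')" by (rule powr_add)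
    also have "\<dots> \<le> 2 * \<mu> powr (- P')" using \<mu>\<delta> by (intro mult_right_mono) auto
    finally show ?thesis by (simp add: visual_weight_def P P')
  qed
  have "boundary_product p \<xi> \<zeta> \<le> boundary_product p \<xi> \<eta> + ereal \<delta> \<or>
        boundary_product p \<zeta> \<eta> \<le> boundary_product p \<xi> \<eta> + ereal \<delta>"
    using boundary_product_hyperbolic[OF hyp \<zeta>, of \<xi> \<eta>] by (simp add: min_le_iff_disj)
  then show ?thesis
  proof
    assume "boundary_product p \<xi> \<zeta> \<le> boundary_product p \<xi> \<eta> + ereal \<delta>"
    then show ?thesis using step[of \<xi> \<zeta>] by linarith
  next
    assume "boundary_product p \<zeta> \<eta> \<le> boundary_product p \<xi> \<eta> + ereal \<delta>"
    then show ?thesis using step[of \<zeta> \<eta>] by linarith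
  qed
qed

lemma visual_dist_bounds:
  assumes hyp: "delta_hyperbolic TYPE('a::metric_space) \<delta>" and \<mu>: "\<mu> = visual_base \<delta>"
    and \<xi>: "\<xi> \<in> boundary (p::'a)" "\<eta> \<in> boundary p"
  shows "visual_dist p \<mu> \<xi> \<eta> \<le> visual_weight p \<mu> \<xi> \<eta>" "visual_weight p \<mu> \<xi> \<eta> \<le> 4 * visual_dist p \<mu> \<xi> \<eta>"
proof -
  let ?A = "{(\<Sum>i=1..n. visual_weight p \<mu> (\<zeta> (i - 1)) (\<zeta> i)) | (n::nat) \<zeta>.
            n \<ge> 1 \<and> \<zeta> 0 = \<xi> \<and> \<zeta> n = \<eta> \<and> (\<forall>i\<le>n. \<zeta> i \<in> boundary p)}"
  have nn: "0 \<le> visual_weight p \<mu> \<xi> \<eta>" for \<xi> \<eta> by (simp add: visual_weight_def)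
  have one: "visual_weight p \<mu> \<xi> \<eta> \<in> ?A"
    by (rule CollectI, rule exI[of _ 1], rule exI[of _ "\<lambda>i. if i = 0 then \<xi> else \<eta>"]) (use \<xi> in auto)
  have "bdd_below ?A" by (rule bdd_belowI[of _ 0]) (auto intro!: sum_nonneg nn)
  then show "visual_dist p \<mu> \<xi> \<eta> \<le> visual_weight p \<mu> \<xi> \<eta>"
    unfolding visual_dist_def by (rule cInf_lower[OF one])
  have lower: "visual_weight p \<mu> \<xi> \<eta> / 4 \<le> (\<Sum>i=1..n. visual_weight p \<mu> (\<zeta> (i - 1)) (\<zeta> i))"
    if n: "1 \<le> n" "\<zeta> 0 = \<xi>" "\<zeta> n = \<eta>" and \<zeta>: "\<forall>i\<le>n. \<zeta> i \<in> boundary p" for n :: nat and \<zeta>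
  proof -
    have "visual_weight p \<mu> (\<zeta> 0) (\<zeta> n) \<le> 4 * (\<Sum>k<n. visual_weight p \<mu> (\<zeta> k) (\<zeta> (Suc k)))"
    proof (rule chain_inequality[where S = "boundary p"])
      show "visual_weight p \<mu> \<xi> \<xi> = 0" if "\<xi> \<in> boundary p" for \<xi>
        using boundary_product_self[OF hyp that] by (simp add: visual_weight_def)
      show "visual_weight p \<mu> \<xi> \<eta> \<le> 2 * max (visual_weight p \<mu> \<xi> \<zeta>) (visual_weight p \<mu> \<zeta> \<eta>)"
        if "\<zeta> \<in> boundary p" for \<xi> \<zeta> \<eta>
        by (rule visual_weight_quasi_ultrametric[OF hyp that \<mu>])
      show "\<zeta> i \<in> boundary p" if "i \<le> n" for i using \<zeta> that by blast
    qed (fact nn n)+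
    then show ?thesis by (simp add: n sum.atLeast1_atMost_eq)
  qed
  have "visual_weight p \<mu> \<xi> \<eta> / 4 \<le> Inf ?A"
  proof (rule cInf_greatest)
    show "?A \<noteq> {}" using one by blast
  next
    fix a assume "a \<in> ?A"
    then obtain n :: nat and \<zeta> where "a = (\<Sum>i=1..n. visual_weight p \<mu> (\<zeta> (i - 1)) (\<zeta> i))"
      "1 \<le> n" "\<zeta> 0 = \<xi>" "\<zeta> n = \<eta>" "\<forall>i\<le>n. \<zeta> i \<in> boundary p" by blast
    then show "visual_weight p \<mu> \<xi> \<eta> / 4 \<le> a" using lower[of n \<zeta>] by simp
  qed
  then show "visual_weight p \<mu> \<xi> \<eta> \<le> 4 * visual_dist p \<mu> \<xi> \<eta>" by (simp add: visual_dist_def)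
qed

lemma log_visual_dist:
  assumes hyp: "delta_hyperbolic TYPE('a::metric_space) \<delta>" and \<mu>: "\<mu> = visual_base \<delta>"
    and \<xi>: "\<xi> \<in> boundary (p::'a)" "\<eta> \<in> boundary p" "\<xi> \<noteq> \<eta>"
  shows "0 < visual_dist p \<mu> \<xi> \<eta>"
    and "log \<mu> (visual_dist p \<mu> \<xi> \<eta>) \<le> - real_product p \<xi> \<eta>"
    and "- real_product p \<xi> \<eta> - log \<mu> 4 \<le> log \<mu> (visual_dist p \<mu> \<xi> \<eta>)"
proof -
  have \<mu>1: "1 < \<mu>" using visual_base_gt_1 by (simp add: \<mu>)
  define w where "w = \<mu> powr (- real_product p \<xi> \<eta>)"
  have w: "visual_weight p \<mu> \<xi> \<eta> = w" "0 < w" and lw: "log \<mu> w = - real_product p \<xi> \<eta>"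
    using visual_weight_distinct[OF hyp \<xi>] \<mu>1 by (simp_all add: w_def log_powr)
  have d: "visual_dist p \<mu> \<xi> \<eta> \<le> w" "w \<le> 4 * visual_dist p \<mu> \<xi> \<eta>"
    using visual_dist_bounds[OF hyp \<mu> \<xi>(1,2)] w by simp_all
  show pos: "0 < visual_dist p \<mu> \<xi> \<eta>" using d w by linarith
  show "log \<mu> (visual_dist p \<mu> \<xi> \<eta>) \<le> - real_product p \<xi> \<eta>"
    using d(1) pos w \<mu>1 by (simp add: lw[symmetric])
  have "log \<mu> w \<le> log \<mu> (4 * visual_dist p \<mu> \<xi> \<eta>)" using d(2) pos w \<mu>1 by simp
  also have "\<dots> = log \<mu> 4 + log \<mu> (visual_dist p \<mu> \<xi> \<eta>)" using pos \<mu>1 by (simp add: log_mult)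
  finally show "- real_product p \<xi> \<eta> - log \<mu> 4 \<le> log \<mu> (visual_dist p \<mu> \<xi> \<eta>)" by (simp add: lw)
qed

lemma log_cross_ratio:
  assumes hyp: "delta_hyperbolic TYPE('a::metric_space) \<delta>" and \<mu>: "\<mu> = visual_base \<delta>"
    and \<xi>: "\<xi>1 \<in> boundary (p::'a)" "\<xi>2 \<in> boundary p" "\<xi>3 \<in> boundary p" "\<xi>4 \<in> boundary p"
    and ne: "\<xi>1 \<noteq> \<xi>3" "\<xi>2 \<noteq> \<xi>4" "\<xi>1 \<noteq> \<xi>4" "\<xi>2 \<noteq> \<xi>3"
  shows "\<bar>log \<mu> (cross_ratio p \<mu> \<xi>1 \<xi>2 \<xi>3 \<xi>4)
     - (real_product p \<xi>1 \<xi>4 + real_product p \<xi>2 \<xi>3 - real_product p \<xi>1 \<xi>3 - real_product p \<xi>2 \<xi>4)\<bar>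
     \<le> 2 * log \<mu> 4"
proof -
  have \<mu>1: "1 < \<mu>" using visual_base_gt_1 by (simp add: \<mu>)
  note b = log_visual_dist[OF hyp \<mu> \<xi>(1,3) ne(1)] log_visual_dist[OF hyp \<mu> \<xi>(2,4) ne(2)]
    log_visual_dist[OF hyp \<mu> \<xi>(1,4) ne(3)] log_visual_dist[OF hyp \<mu> \<xi>(2,3) ne(4)]
  have "log \<mu> (cross_ratio p \<mu> \<xi>1 \<xi>2 \<xi>3 \<xi>4) =
      (log \<mu> (visual_dist p \<mu> \<xi>1 \<xi>3) + log \<mu> (visual_dist p \<mu> \<xi>2 \<xi>4)) -
      (log \<mu> (visual_dist p \<mu> \<xi>1 \<xi>4) + log \<mu> (visual_dist p \<mu> \<xi>2 \<xi>3))"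
    unfolding cross_ratio_def using b(1,4,7,10) \<mu>1 by (simp add: log_divide log_mult)
  then show ?thesis using b by linarith
qed

section \<open>The induced boundary map\<close>

lemma boundary_class:
  assumes hyp: "delta_hyperbolic TYPE('a::metric_space) \<delta>" and "gromov_seq (p::'a) x"
  shows "gromov_rel p `` {x} \<in> boundary p" "x \<in> gromov_rel p `` {x}"
  using assms(2) equiv_class_self[OF equiv_gromov_rel[OF hyp, of p], of x]
  by (auto simp: boundary_def quotient_def)

text \<open>The images of all representatives, saturated under equivalence; no representative is chosen.\<close>

definition induced_map :: "'b::metric_space \<Rightarrow> ('a \<Rightarrow> 'b) \<Rightarrow> (nat \<Rightarrow> 'a) set \<Rightarrow> (nat \<Rightarrow> 'b) set" where
  "induced_map q f \<xi> = gromov_rel q `` ((\<lambda>x. f \<circ> x) ` \<xi>)"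

text \<open>Preserving large products makes the boundary map well defined, and preserving bounded products
  makes it injective.\<close>

context
  fixes p :: "'a::metric_space" and q :: "'b::metric_space" and f :: "'a \<Rightarrow> 'b" and \<delta> :: real
  assumes hypa: "delta_hyperbolic TYPE('a) \<delta>" and hypb: "delta_hyperbolic TYPE('b) \<delta>"
    and proper_products: "\<And>c. \<exists>R. \<forall>x y. R \<le> gp p x y \<longrightarrow> c \<le> gp q (f x) (f y)"
    and bounded_products: "\<And>c. \<exists>R. \<forall>x y. gp p x y \<le> c \<longrightarrow> gp q (f x) (f y) \<le> R"
begin

lemma gromov_seq_image:
  assumes "gromov_seq p x"
  shows "gromov_seq q (f \<circ> x)"
  unfolding gromov_seq_iff
proof
  fix c
  obtain R where "\<And>x y. R \<le> gp p x y \<Longrightarrow> c \<le> gp q (f x) (f y)" using proper_products by blast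
  then show "\<exists>N. \<forall>n\<ge>N. \<forall>m\<ge>N. c \<le> gp q ((f \<circ> x) n) ((f \<circ> x) m)"
    using assms unfolding gromov_seq_iff by (metis comp_apply)
qed

lemma gromov_rel_image_iff:
  assumes "gromov_seq p x" "gromov_seq p y"
  shows "(f \<circ> x, f \<circ> y) \<in> gromov_rel q \<longleftrightarrow> (x, y) \<in> gromov_rel p"
proof
  assume "(x, y) \<in> gromov_rel p"
  moreover have "\<exists>N. \<forall>n\<ge>N. c \<le> gp q (f (x n)) (f (y n))"
    if "\<forall>c. \<exists>N. \<forall>n\<ge>N. c \<le> gp p (x n) (y n)" for c
    using proper_products[of c] that by meson
  ultimately show "(f \<circ> x, f \<circ> y) \<in> gromov_rel q"
    using assms by (simp add: gromov_rel_iff gromov_seq_image)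
next
  assume r: "(f \<circ> x, f \<circ> y) \<in> gromov_rel q"
  have "\<exists>N. \<forall>n\<ge>N. c \<le> gp p (x n) (y n)" for c
  proof -
    obtain R where R: "\<And>x y. gp p x y \<le> c \<Longrightarrow> gp q (f x) (f y) \<le> R" using bounded_products by blast
    obtain N where N: "\<And>n. n \<ge> N \<Longrightarrow> R + 1 \<le> gp q (f (x n)) (f (y n))"
      using r unfolding gromov_rel_iff comp_apply by meson
    have "c \<le> gp p (x n) (y n)" if "n \<ge> N" for n
      using N[OF that] R[of "x n" "y n"] by linarith
    then show ?thesis by blast
  qed
  then show "(x, y) \<in> gromov_rel p" using assms by (simp add: gromov_rel_iff)
qed

lemma induced_map_class:
  assumes x: "gromov_seq p x"
  shows "induced_map q f (gromov_rel p `` {x}) = gromov_rel q `` {f \<circ> x}"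
proof -
  have "gromov_rel q `` {f \<circ> x'} = gromov_rel q `` {f \<circ> x}" if "(x, x') \<in> gromov_rel p" for x'
  proof (rule equiv_class_eq[OF equiv_gromov_rel[OF hypb], symmetric])
    show "(f \<circ> x, f \<circ> x') \<in> gromov_rel q"
      using gromov_rel_image_iff[of x x'] that x by (auto simp: gromov_rel_iff)
  qed
  moreover have "(x, x) \<in> gromov_rel p" using boundary_class(2)[OF hypa x] by simp
  ultimately show ?thesis unfolding induced_map_def by blast
qed

lemma induced_map_member:
  assumes "\<xi> \<in> boundary p" "x \<in> \<xi>"
  shows "induced_map q f \<xi> \<in> boundary q" "f \<circ> x \<in> induced_map q f \<xi>"
proof -
  have x: "gromov_seq p x" using boundary_member_seq[OF hypa assms] .
  have "induced_map q f \<xi> = gromov_rel q `` {f \<circ> x}"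
    using boundary_eq_class[OF hypa assms] induced_map_class[OF x] by simp
  then show "induced_map q f \<xi> \<in> boundary q" "f \<circ> x \<in> induced_map q f \<xi>"
    using boundary_class[OF hypb gromov_seq_image[OF x]] by auto
qed

lemma induces_boundary_map_induced_map: "induces_boundary_map p q f (induced_map q f)"
proof -
  have "induced_map q f \<xi> \<in> boundary q" if "\<xi> \<in> boundary p" for \<xi>
    using boundary_nonempty[OF hypa that] induced_map_member(1)[OF that] by metis
  then show ?thesis
    unfolding induces_boundary_map_def using gromov_seq_image induced_map_class by blast
qed

lemma inj_on_induced_map: "inj_on (induced_map q f) (boundary p)"
proof (rule inj_onI, rule ccontr)
  fix \<xi> \<eta> assume \<xi>: "\<xi> \<in> boundary p" "\<eta> \<in> boundary p" "induced_map q f \<xi> = induced_map q f \<eta>"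
    and ne: "\<xi> \<noteq> \<eta>"
  obtain x where x: "x \<in> \<xi>" using boundary_nonempty[OF hypa \<xi>(1)] .
  obtain y where y: "y \<in> \<eta>" using boundary_nonempty[OF hypa \<xi>(2)] .
  have "(f \<circ> x, f \<circ> y) \<in> gromov_rel q"
    using boundary_member_rel[OF hypb induced_map_member(1)[OF \<xi>(1) x] induced_map_member(2)[OF \<xi>(1) x]]
      induced_map_member(2)[OF \<xi>(2) y] \<xi>(3) by simp
  then have "(x, y) \<in> gromov_rel p"
    using gromov_rel_image_iff boundary_member_seq[OF hypa] \<xi> x y by blast
  then show False using boundary_distinct_not_rel[OF hypa \<xi>(1,2) ne x y] by simp
qed

end

lemma sup_product_ge:
  assumes I: "finite I" "i \<in> I" "j \<in> I" "i \<noteq> j"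
    and fin: "\<And>i j. \<lbrakk>i \<in> I; j \<in> I; i \<noteq> j\<rbrakk> \<Longrightarrow> \<bar>boundary_product p (\<xi> i) (\<xi> j)\<bar> \<noteq> \<infinity>"
  shows "real_product p (\<xi> i) (\<xi> j) \<le> sup_product p I \<xi>"
proof -
  define A where "A = (\<lambda>(i, j). boundary_product p (\<xi> i) (\<xi> j)) ` {(i, j). i \<in> I \<and> j \<in> I \<and> i \<noteq> j}"
  have "finite {(i, j). i \<in> I \<and> j \<in> I \<and> i \<noteq> j}"
    by (rule finite_subset[of _ "I \<times> I"]) (use I in auto)
  then have A: "finite A" "boundary_product p (\<xi> i) (\<xi> j) \<in> A" using I by (auto simp: A_def)
  then have "Sup A \<in> A" using Max_in[of A] Max_Sup[of A] by fastforce
  moreover have "a \<noteq> \<infinity>" if "a \<in> A" for a using that fin by (fastforce simp: A_def)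
  ultimately have "Sup A \<noteq> \<infinity>" by blast
  then have "real_product p (\<xi> i) (\<xi> j) \<le> real_of_ereal (Sup A)"
    by (intro real_of_ereal_positive_mono boundary_product_nonneg Sup_upper A)
  then show ?thesis by (simp add: sup_product_def A_def)
qed

text \<open>The two bounds on products that produce the boundary map. The products of the images are
  computed at \<open>q\<close> instead of \<open>f p\<close>, which costs the constant \<open>dist q (f p)\<close>; they tend to infinity
  with \<open>r\<close> because \<open>l * r\<close> dominates \<open>K * u r\<close>.\<close>

lemma SBE_product_bounds:
  fixes p :: "'a::metric_space" and q :: "'b::metric_space" and f :: "'a \<Rightarrow> 'b"
  assumes u: "admissible u" and l: "0 < l" and L: "0 < L"
    and geoa: "geodesic_space TYPE('a)" and geob: "geodesic_space TYPE('b)"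
    and hypa: "delta_hyperbolic TYPE('a) \<delta>" and hypb: "delta_hyperbolic TYPE('b) \<delta>"
    and C: "0 \<le> C" and f: "sublinear_biLipschitz_bounds p l L (\<lambda>r. C * u r) f"
  shows "\<exists>R. \<forall>x y. R \<le> gp p x y \<longrightarrow> c \<le> gp q (f x) (f y)"
    and "\<exists>R. \<forall>x y. gp p x y \<le> c \<longrightarrow> gp q (f x) (f y) \<le> R"
proof -
  obtain K where K: "0 \<le> K" "\<And>x y. \<exists>r. gp p x y \<le> r \<and> r \<le> gp p x y + 2 * \<delta> \<and>
        l * r - K * u r \<le> gp (f p) (f x) (f y) \<and> gp (f p) (f x) (f y) \<le> L * r + K * u r"
    using product_distortion[OF u l L geoa geob hypa hypb C f] by metis
  obtain R where R: "\<And>r. R \<le> r \<Longrightarrow> c + dist q (f p) \<le> l * r - K * u r"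
    using admissible_dominated_by_linear[OF u l K(1)] by blast
  have "c \<le> gp q (f x) (f y)" if xy: "R \<le> gp p x y" for x y
  proof -
    obtain r where r: "gp p x y \<le> r" "l * r - K * u r \<le> gp (f p) (f x) (f y)" using K(2) by blast
    show ?thesis using R[of r] r xy gp_change_base[of "f p" "f x" "f y" q] by (simp add: dist_commute)
  qed
  then show "\<exists>R. \<forall>x y. R \<le> gp p x y \<longrightarrow> c \<le> gp q (f x) (f y)" by blast
  have "gp q (f x) (f y) \<le> L * (c + 2 * \<delta>) + K * u (c + 2 * \<delta>) + dist q (f p)" if xy: "gp p x y \<le> c" for x y
  proof -
    obtain r where r: "gp p x y \<le> r" "r \<le> gp p x y + 2 * \<delta>" "gp (f p) (f x) (f y) \<le> L * r + K * u r"
      using K(2) by blast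
    have r0: "0 \<le> r" "r \<le> c + 2 * \<delta>" using r xy gp_nonneg[of p x y] by linarith+
    then have "L * r + K * u r \<le> L * (c + 2 * \<delta>) + K * u (c + 2 * \<delta>)"
      using L K admissible_mono[OF u r0] by (intro add_mono mult_left_mono) auto
    then show ?thesis using r gp_change_base[of q "f x" "f y" "f p"] by linarith
  qed
  then show "\<exists>R. \<forall>x y. gp p x y \<le> c \<longrightarrow> gp q (f x) (f y) \<le> R" by blast
qed

section \<open>Distortion of cross-ratios\<close>

theorem theorem1:
  fixes u :: "real \<Rightarrow> real" and l L \<delta> \<mu> :: real
    and p :: "'a::metric_space" and q :: "'b::metric_space" and f :: "'a \<Rightarrow> 'b"
  assumes "admissible u"
    and "l > 0" and "L > 0"
    and "proper_space TYPE('a)" and "geodesic_space TYPE('a)"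
    and "proper_space TYPE('b)" and "geodesic_space TYPE('b)"
    and "\<delta> \<ge> 0" and "delta_hyperbolic TYPE('a) \<delta>" and "delta_hyperbolic TYPE('b) \<delta>"
    and "\<mu> = visual_base \<delta>"
    and "SBE p q l L u f"
  shows "\<exists>\<phi>. induces_boundary_map p q f \<phi> \<and>
    (\<exists>(v :: real \<Rightarrow> real) E. v \<in> O[at_top](u) \<and> ((\<lambda>r. v r / r) \<longlongrightarrow> 0) at_top \<and> E > 0 \<and>
      (\<forall>\<xi> :: nat \<Rightarrow> (nat \<Rightarrow> 'a) set.
         (\<forall>i\<in>{1..4}. \<xi> i \<in> boundary p) \<and> inj_on \<xi> {1..4} \<and>
         (\<forall>i\<in>{1..4}. \<forall>j\<in>{1..4}. i \<noteq> j \<longrightarrow> visual_dist p \<mu> (\<xi> i) (\<xi> j) < E) \<longrightarrow>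
         inj_on (\<lambda>i. \<phi> (\<xi> i)) {1..4} \<and>
         l * log_plus \<mu> (cross_ratio p \<mu> (\<xi> 1) (\<xi> 2) (\<xi> 3) (\<xi> 4)) - v (sup_product p {1..4} \<xi>)
           \<le> log_plus \<mu> (cross_ratio q \<mu> (\<phi> (\<xi> 1)) (\<phi> (\<xi> 2)) (\<phi> (\<xi> 3)) (\<phi> (\<xi> 4))) \<and>
         log_plus \<mu> (cross_ratio q \<mu> (\<phi> (\<xi> 1)) (\<phi> (\<xi> 2)) (\<phi> (\<xi> 3)) (\<phi> (\<xi> 4)))
           \<le> L * log_plus \<mu> (cross_ratio p \<mu> (\<xi> 1) (\<xi> 2) (\<xi> 3) (\<xi> 4)) + v (sup_product p {1..4} \<xi>)))"
proof -
  note u = assms(1) and l = assms(2) and L = assms(3) and geoa = assms(5) and geob = assms(7)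
    and \<delta> = assms(8) and hypa = assms(9) and hypb = assms(10) and \<mu> = assms(11)
  obtain C where C: "0 \<le> C" and f: "sublinear_biLipschitz_bounds p l L (\<lambda>r. C * u r) f"
    using SBE_imp_bounds[OF u assms(12)] .
  note pb = SBE_product_bounds[OF u l L geoa geob hypa hypb C f, where q = q]
  define \<phi> where "\<phi> = induced_map q f"
  have \<phi>: "induces_boundary_map p q f \<phi>"
    unfolding \<phi>_def by (rule induces_boundary_map_induced_map[OF hypa hypb pb])
  have inj: "inj_on \<phi> (boundary p)"
    unfolding \<phi>_def by (rule inj_on_induced_map[OF hypa hypb pb])
  have mem: "\<phi> \<xi> \<in> boundary q" "f \<circ> x \<in> \<phi> \<xi>" if "\<xi> \<in> boundary p" "x \<in> \<xi>" for \<xi> x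
    unfolding \<phi>_def using induced_map_member[OF hypa hypb pb that] by auto
  obtain K where K: "0 \<le> K" and distortion:
    "\<And>x1 x2 x3 x4 R. \<lbrakk>0 \<le> R; gp p x1 x2 \<le> R; gp p x1 x3 \<le> R; gp p x1 x4 \<le> R;
        gp p x2 x3 \<le> R; gp p x2 x4 \<le> R; gp p x3 x4 \<le> R\<rbrakk> \<Longrightarrow>
      l * max 0 (cross_difference x1 x2 x3 x4) - K * u R
        \<le> max 0 (cross_difference (f x1) (f x2) (f x3) (f x4)) \<and>
      max 0 (cross_difference (f x1) (f x2) (f x3) (f x4))
        \<le> L * max 0 (cross_difference x1 x2 x3 x4) + K * u R"
    using cross_difference_distortion[OF u l L geoa geob hypa hypb C f] by blast
  \<comment> \<open>The error of replacing boundary products by products of points; \<open>e\<close> is the resulting error for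
    logarithms of cross-ratios, which involve four products and four visual distances.\<close>
  define c where "c = 2 * \<delta> + 1"
  have c: "0 \<le> c" using \<delta> by (simp add: c_def)
  obtain B where B: "1 \<le> B" "\<And>r. 0 \<le> r \<Longrightarrow> u (r + c) \<le> B * u r"
    using admissible_shift[OF u c] by blast
  define e where "e = 4 * c + 2 * log \<mu> 4"
  have "0 \<le> log \<mu> 4" using visual_base_gt_1[of \<delta>] by (simp add: \<mu>)
  then have e: "0 \<le> e" using c by (simp add: e_def)
  define V where "V = K * B + (l + L + 1) * e"
  define v where "v r = V * u r" for r
  have main: "inj_on (\<lambda>i. \<phi> (\<xi> i)) {1..4} \<and>
         l * log_plus \<mu> (cross_ratio p \<mu> (\<xi> 1) (\<xi> 2) (\<xi> 3) (\<xi> 4)) - v (sup_product p {1..4} \<xi>)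
           \<le> log_plus \<mu> (cross_ratio q \<mu> (\<phi> (\<xi> 1)) (\<phi> (\<xi> 2)) (\<phi> (\<xi> 3)) (\<phi> (\<xi> 4))) \<and>
         log_plus \<mu> (cross_ratio q \<mu> (\<phi> (\<xi> 1)) (\<phi> (\<xi> 2)) (\<phi> (\<xi> 3)) (\<phi> (\<xi> 4)))
           \<le> L * log_plus \<mu> (cross_ratio p \<mu> (\<xi> 1) (\<xi> 2) (\<xi> 3) (\<xi> 4)) + v (sup_product p {1..4} \<xi>)"
    if \<xi>: "\<And>i. i \<in> {1..4} \<Longrightarrow> \<xi> i \<in> boundary p" and dis: "inj_on \<xi> {1..4}" for \<xi> :: "nat \<Rightarrow> (nat \<Rightarrow> 'a) set"
  proof -
    have inj\<phi>: "inj_on (\<lambda>i. \<phi> (\<xi> i)) {1..4}"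
      using comp_inj_on[OF dis inj_on_subset[OF inj]] \<xi> by (simp add: comp_def image_subset_iff)
    have ne: "\<xi> i \<noteq> \<xi> j" "\<phi> (\<xi> i) \<noteq> \<phi> (\<xi> j)" if "i \<in> {1..4}" "j \<in> {1..4}" "i \<noteq> j" for i j
      using inj_onD[OF dis] inj_onD[OF inj\<phi>] that by blast+
    have "\<forall>i\<in>{1..4}. \<exists>x. x \<in> \<xi> i" using boundary_nonempty[OF hypa \<xi>] by metis
    then obtain x where x: "\<And>i. i \<in> {1..4} \<Longrightarrow> x i \<in> \<xi> i" by metis
    have \<phi>b: "\<phi> (\<xi> i) \<in> boundary q" "f \<circ> x i \<in> \<phi> (\<xi> i)" if "i \<in> {1..4}" for i
      using mem[OF \<xi>[OF that] x[OF that]] by auto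
    have "eventually (\<lambda>n. \<forall>i\<in>{1..4}. \<forall>j\<in>{1..4}. i \<noteq> j \<longrightarrow>
        \<bar>gp p (x i n) (x j n) - real_product p (\<xi> i) (\<xi> j)\<bar> \<le> c \<and>
        \<bar>gp q (f (x i n)) (f (x j n)) - real_product q (\<phi> (\<xi> i)) (\<phi> (\<xi> j))\<bar> \<le> c) sequentially"
    proof (intro eventually_ball_finite ballI finite_atLeastAtMost)
      fix i j :: nat assume ij: "i \<in> {1..4}" "j \<in> {1..4}"
      show "eventually (\<lambda>n. i \<noteq> j \<longrightarrow>
        \<bar>gp p (x i n) (x j n) - real_product p (\<xi> i) (\<xi> j)\<bar> \<le> c \<and>
        \<bar>gp q (f (x i n)) (f (x j n)) - real_product q (\<phi> (\<xi> i)) (\<phi> (\<xi> j))\<bar> \<le> c) sequentially"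
      proof (cases "i = j")
        case False
        have "eventually (\<lambda>n. \<bar>gp p (x i n) (x j n) - real_product p (\<xi> i) (\<xi> j)\<bar> \<le> c) sequentially"
          unfolding c_def by (intro boundary_product_approx[OF hypa] \<xi> x ne ij False)
        moreover have "eventually (\<lambda>n. \<bar>gp q ((f \<circ> x i) n) ((f \<circ> x j) n)
            - real_product q (\<phi> (\<xi> i)) (\<phi> (\<xi> j))\<bar> \<le> c) sequentially"
          unfolding c_def by (intro boundary_product_approx[OF hypb] \<phi>b ne ij False)
        ultimately show ?thesis by eventually_elim simp
      qed simp
    qed
    \<comment> \<open>A single index at which all boundary products, before and after \<open>f\<close>, are approximated.\<close>
    from eventually_happens'[OF sequentially_bot this]
    obtain n where n: "\<And>i j. \<lbrakk>i \<in> {1..4}; j \<in> {1..4}; i \<noteq> j\<rbrakk> \<Longrightarrow>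
        \<bar>gp p (x i n) (x j n) - real_product p (\<xi> i) (\<xi> j)\<bar> \<le> c \<and>
        \<bar>gp q (f (x i n)) (f (x j n)) - real_product q (\<phi> (\<xi> i)) (\<phi> (\<xi> j))\<bar> \<le> c"
      by blast
    have I: "(1::nat) \<in> {1..4}" "(2::nat) \<in> {1..4}" "(3::nat) \<in> {1..4}" "(4::nat) \<in> {1..4}" by auto
    have neq: "(1::nat) \<noteq> 4" "(2::nat) \<noteq> 3" "(1::nat) \<noteq> 3" "(2::nat) \<noteq> 4" by auto
    note approx = n[OF I(1,4) neq(1)] n[OF I(2,3) neq(2)] n[OF I(1,3) neq(3)] n[OF I(2,4) neq(4)]
    define s where "s = sup_product p {1..4} \<xi>"
    have s: "real_product p (\<xi> i) (\<xi> j) \<le> s" if "i \<in> {1..4}" "j \<in> {1..4}" "i \<noteq> j" for i j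
      unfolding s_def using that by (intro sup_product_ge boundary_product_finite[OF hypa] \<xi> ne) auto
    have s0: "0 \<le> s"
      using s[of 1 2] real_of_ereal_pos[OF boundary_product_nonneg[of p "\<xi> 1" "\<xi> 2"]] by simp
    have us: "1 \<le> u s" using admissible_ge_1[OF u s0] .
    have R: "gp p (x i n) (x j n) \<le> s + c" if "i \<in> {1..4}" "j \<in> {1..4}" "i \<noteq> j" for i j
      using n[OF that] s[OF that] by linarith
    define S where "S = cross_difference (x 1 n) (x 2 n) (x 3 n) (x 4 n)"
    define S' where "S' = cross_difference (f (x 1 n)) (f (x 2 n)) (f (x 3 n)) (f (x 4 n))"
    have "K * u (s + c) \<le> K * (B * u s)" using B(2)[OF s0] K by (rule mult_left_mono)
    moreover have "l * max 0 S - K * u (s + c) \<le> max 0 S' \<and> max 0 S' \<le> L * max 0 S + K * u (s + c)"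
      unfolding S_def S'_def by (intro distortion R) (use s0 c in auto)
    ultimately have SS': "l * max 0 S - K * B * u s \<le> max 0 S'" "max 0 S' \<le> L * max 0 S + K * B * u s"
      by (simp_all add: mult.assoc)
    define t where "t = log \<mu> (cross_ratio p \<mu> (\<xi> 1) (\<xi> 2) (\<xi> 3) (\<xi> 4))"
    define t' where "t' = log \<mu> (cross_ratio q \<mu> (\<phi> (\<xi> 1)) (\<phi> (\<xi> 2)) (\<phi> (\<xi> 3)) (\<phi> (\<xi> 4)))"
    have "\<bar>t - (real_product p (\<xi> 1) (\<xi> 4) + real_product p (\<xi> 2) (\<xi> 3)
        - real_product p (\<xi> 1) (\<xi> 3) - real_product p (\<xi> 2) (\<xi> 4))\<bar> \<le> 2 * log \<mu> 4"
      unfolding t_def by (intro log_cross_ratio[OF hypa \<mu>] \<xi> ne) auto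
    then have t: "\<bar>t - S\<bar> \<le> e"
      using approx unfolding S_def e_def cross_difference_gp[of _ _ _ _ p] abs_le_iff
      by (elim conjE) linarith
    have "\<bar>t' - (real_product q (\<phi> (\<xi> 1)) (\<phi> (\<xi> 4)) + real_product q (\<phi> (\<xi> 2)) (\<phi> (\<xi> 3))
        - real_product q (\<phi> (\<xi> 1)) (\<phi> (\<xi> 3)) - real_product q (\<phi> (\<xi> 2)) (\<phi> (\<xi> 4)))\<bar> \<le> 2 * log \<mu> 4"
      unfolding t'_def by (intro log_cross_ratio[OF hypb \<mu>] \<phi>b ne) auto
    then have t': "\<bar>t' - S'\<bar> \<le> e"
      using approx unfolding S'_def e_def cross_difference_gp[of _ _ _ _ q] abs_le_iff
      by (elim conjE) linarith
    have "v s = K * B * u s + (l * e * u s + L * e * u s + e * u s)"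
      by (simp add: v_def V_def algebra_simps)
    moreover have "l * e \<le> l * e * u s" "L * e \<le> L * e * u s" "e \<le> e * u s"
      using us mult_left_mono[OF us, of "l * e"] mult_left_mono[OF us, of "L * e"]
        mult_left_mono[OF us, of e] l L e by auto
    moreover have "0 \<le> l * e" "0 \<le> L * e" using l L e by auto
    ultimately have vs: "K * B * u s + l * e + e \<le> v s" "K * B * u s + L * e + e \<le> v s" by linarith+
    have close: "max 0 t - e \<le> max 0 S" "max 0 S \<le> max 0 t + e"
      "max 0 t' - e \<le> max 0 S'" "max 0 S' \<le> max 0 t' + e" using t t' e by linarith+
    have "l * (max 0 t - e) \<le> l * max 0 S" using close(1) l by (intro mult_left_mono) auto
    then have "l * max 0 t - l * e \<le> l * max 0 S" by (simp only: right_diff_distrib)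
    then have "l * max 0 t - v s + e \<le> max 0 S'" using SS'(1) vs(1) by linarith
    then have lower: "l * max 0 t - v s \<le> max 0 t'" using close(4) by linarith
    have "L * max 0 S \<le> L * (max 0 t + e)" using close(2) L by (intro mult_left_mono) auto
    then have "L * max 0 S \<le> L * max 0 t + L * e" by (simp only: distrib_left)
    then have "max 0 t' \<le> L * max 0 t + v s" using SS'(2) vs(2) close(3) by linarith
    with lower show ?thesis using inj\<phi> by (simp add: log_plus_def t_def t'_def s_def)
  qed
  have vO: "v \<in> O[at_top](u)" unfolding v_def by (rule bigoI[of _ "\<bar>V\<bar>"]) (simp add: abs_mult)
  have "((\<lambda>r. V * (u r / r)) \<longlongrightarrow> V * 0) at_top"
    using u by (intro tendsto_intros) (simp add: admissible_def)
  then have "((\<lambda>r. v r / r) \<longlongrightarrow> 0) at_top" by (simp add: v_def)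
  then show ?thesis using \<phi> vO main
    by (intro exI[of _ \<phi>] conjI exI[of _ v] exI[of _ "1::real"]) auto
qed

end
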